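(* Let $\chi\colon\mathbb T\mathbb S\to\mathbb S\mathbb T$ be a comonad distributive law between comonads $\mathbb T=(T,\Delta^T,\epsilon^T)$ and $\mathbb S=(S,\Delta^S,\epsilon^S)$ on a category $\mathcal B$, let $(M,\mathcal Y,\rho)$ be a right $\chi$-coalgebra and $(N,\mathcal Z,\lambda)$ a left $\chi$-coalgebra. Consider the duplicial functors $\mathrm C_{\mathbb T}(N,M)$ and $\mathrm C_{\mathbb S}^{\mathrm{op}}(N,M)$ with duplicial operators $t^{\mathbb T}$ and $t^{\mathbb S}$. Then the natural transformations $R_n\colon NT^{n+1}M\to NS^{n+1}M$ and $L_n\colon NS^{n+1}M\to NT^{n+1}M$ ($n\ge0$) define two morphisms of duplicial functors $$R\colon\mathrm C_{\mathbb T}(N,M)\to\mathrm C_{\mathbb S}^{\mathrm{op}}(N,M),\qquad L\colon\mathrm C_{\mathbb S}^{\mathrm{op}}(N,M)\to\mathrm C_{\mathbb T}(N,M).$$ Furthermore, $L\circ R=\mathrm{id}$ if and only if $\mathrm C_{\mathbb T}(N,M)$ is cyclic, and $R\circ L=\mathrm{id}$ if and only if $\mathrm C_{\mathbb S}^{\mathrm{op}}(N,M)$ is cyclic.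
   Context: Juxtaposition denotes composition of functors and whiskering. A comonad distributive law $\chi\colon\mathbb T\mathbb S\to\mathbb S\mathbb T$ is a natural transformation $\chi\colon TS\to ST$ with $S\epsilon^T\circ\chi=\epsilon^TS$, $S\Delta^T\circ\chi=\chi T\circ T\chi\circ\Delta^TS$, $\epsilon^ST\circ\chi=T\epsilon^S$, $\Delta^ST\circ\chi=S\chi\circ\chi S\circ T\Delta^S$. A right $\chi$-coalgebra $(M,\mathcal Y,\rho)$ is a functor $M\colon\mathcal Y\to\mathcal B$ with a natural transformation $\rho\colon TM\to SM$ such that $\epsilon^SM\circ\rho=\epsilon^TM$ and $\Delta^SM\circ\rho=S\rho\circ\chi M\circ T\rho\circ\Delta^TM$. A left $\chi$-coalgebra $(N,\mathcal Z,\lambda)$ is a functor $N\colon\mathcal B\to\mathcal Z$ with a natural transformation $\lambda\colon NS\to NT$ such that $N\epsilon^T\circ\lambda=N\epsilon^S$ and $N\Delta^T\circ\lambda=\lambda T\circ N\chi\circ\lambda S\circ N\Delta^S$. A duplicial object is a simplicial object $(C,d_i,s_j)$ with morphisms $t\colon C_n\to C_n$ satisfying $d_it=td_{i-1}$ for $1\le i\le n$, $d_0t=d_n$, $s_jt=ts_{j-1}$ for $1\le j\le n$, $s_0t=t^2s_n$. It is cyclic if $t^{n+1}=\mathrm{id}$ on $C_n$ for all $n$. Morphisms of duplicial objects are morphisms of simplicial objects commuting with $t$. Duplicial functors are duplicial objects in the category of functors $\mathcal Y\to\mathcal Z$. $\mathrm C_{\mathbb T}(N,M)$ is the simplicial functor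 with $\mathrm C_{\mathbb T}(N,M)_n=NT^{n+1}M$, $d_i=NT^i\epsilon^TT^{n-i}M$, $s_j=NT^j\Delta^TT^{n-j}M$ (in degree $n$). $\mathrm C^{\mathrm{op}}_{\mathbb S}(N,M)$ is the simplicial functor with $\mathrm C^{\mathrm{op}}_{\mathbb S}(N,M)_n=NS^{n+1}M$, $d_i=NS^{n-i}\epsilon^SS^iM$, $s_j=NS^{n-j}\Delta^SS^jM$. Let $\chi^n$ denote both the natural transformation $T^nS\to ST^n$ and the natural transformation $TS^n\to S^nT$ obtained by repeated application of $\chi$ ($\chi^0=\mathrm{id}$). The duplicial operators (which make these simplicial functors duplicial) are $$t^{\mathbb T}_n=\lambda T^nM\circ N\chi^nM\circ NT^n\rho\colon NT^{n+1}M\to NT^{n+1}M,\qquad t^{\mathbb S}_n=NS^n\rho\circ N\chi^nM\circ\lambda S^nM\colon NS^{n+1}M\to NS^{n+1}M.$$ For $0\le i\le n$ let $r_{i,n}=NS^i\chi^{n-i}M\circ NS^iT^{n-i}\rho\colon NS^iT^{n+1-i}M\to NS^{i+1}T^{n-i}M$ and $R_n=r_{n,n}\circ\cdots\circ r_{0,n}$. Similarly let $l_{i,n}=N\chi^{n-i}T^iM\circ\lambda S^{n-i}T^iM\colon NS^{n+1-i}T^iM\to NS^{n-i}T^{i+1}M$ and $L_n=l_{n,n}\circ\cdots\circ l_{0,n}$. *)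

theory Defs
  imports "HOL-Library.FuncSet"
begin

section \<open>Categories\<close>

record ('o, 'a) cat =
  Ob :: "'o set"
  Ar :: "'a set"
  Dom :: "'a \<Rightarrow> 'o"
  Cod :: "'a \<Rightarrow> 'o"
  Id :: "'o \<Rightarrow> 'a"
  Comp :: "'a \<Rightarrow> 'a \<Rightarrow> 'a"  (infixr "\<cdot>\<index>" 65)

definition hom :: "('o, 'a) cat \<Rightarrow> 'o \<Rightarrow> 'o \<Rightarrow> 'a set" where
  "hom C x y = {f \<in> Ar C. Dom C f = x \<and> Cod C f = y}"

locale category =
  fixes C :: "('o, 'a) cat"
  assumes Dom_in: "f \<in> Ar C \<Longrightarrow> Dom C f \<in> Ob C"
    and Cod_in: "f \<in> Ar C \<Longrightarrow> Cod C f \<in> Ob C"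
    and Id_in: "x \<in> Ob C \<Longrightarrow> Id C x \<in> hom C x x"
    and Comp_in: "\<lbrakk>g \<in> hom C y z; f \<in> hom C x y\<rbrakk> \<Longrightarrow> g \<cdot>\<^bsub>C\<^esub> f \<in> hom C x z"
    and Id_left: "f \<in> hom C x y \<Longrightarrow> Id C y \<cdot>\<^bsub>C\<^esub> f = f"
    and Id_right: "f \<in> hom C x y \<Longrightarrow> f \<cdot>\<^bsub>C\<^esub> Id C x = f"
    and assoc: "\<lbrakk>h \<in> hom C z w; g \<in> hom C y z; f \<in> hom C x y\<rbrakk>
      \<Longrightarrow> (h \<cdot>\<^bsub>C\<^esub> g) \<cdot>\<^bsub>C\<^esub> f = h \<cdot>\<^bsub>C\<^esub> (g \<cdot>\<^bsub>C\<^esub> f)"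

primrec arr_pow :: "('o, 'a) cat \<Rightarrow> 'a \<Rightarrow> nat \<Rightarrow> 'a" where
  "arr_pow C f 0 = Id C (Dom C f)"
| "arr_pow C f (Suc n) = f \<cdot>\<^bsub>C\<^esub> arr_pow C f n"


section \<open>Functors and natural transformations\<close>

text \<open>Functors and natural transformations carry their source and target, and their
  maps are extensional (\<open>undefined\<close> off the source category). Hence equality in HOL of
  two functors, or of two natural transformations, is equality in the mathematical sense.\<close>

record ('oa, 'aa, 'ob, 'ab) ftor =
  Src :: "('oa, 'aa) cat"
  Tgt :: "('ob, 'ab) cat"
  OMap :: "'oa \<Rightarrow> 'ob"
  AMap :: "'aa \<Rightarrow> 'ab"

locale is_functor = A: category A + B: category B
  for A :: "('oa, 'aa) cat" and B :: "('ob, 'ab) cat" +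
  fixes F :: "('oa, 'aa, 'ob, 'ab) ftor"
  assumes Src_eq: "Src F = A"
    and Tgt_eq: "Tgt F = B"
    and OMap_in: "OMap F \<in> Ob A \<rightarrow>\<^sub>E Ob B"
    and AMap_ext: "AMap F \<in> extensional (Ar A)"
    and AMap_in: "f \<in> hom A x y \<Longrightarrow> AMap F f \<in> hom B (OMap F x) (OMap F y)"
    and AMap_Id: "x \<in> Ob A \<Longrightarrow> AMap F (Id A x) = Id B (OMap F x)"
    and AMap_Comp: "\<lbrakk>g \<in> hom A y z; f \<in> hom A x y\<rbrakk>
      \<Longrightarrow> AMap F (g \<cdot>\<^bsub>A\<^esub> f) = AMap F g \<cdot>\<^bsub>B\<^esub> AMap F f"

definition id_functor :: "('o, 'a) cat \<Rightarrow> ('o, 'a, 'o, 'a) ftor" where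
  "id_functor A = \<lparr>Src = A, Tgt = A, OMap = (\<lambda>x\<in>Ob A. x), AMap = (\<lambda>f\<in>Ar A. f)\<rparr>"

definition functor_comp ::
  "('ob, 'ab, 'oc, 'ac) ftor \<Rightarrow> ('oa, 'aa, 'ob, 'ab) ftor \<Rightarrow> ('oa, 'aa, 'oc, 'ac) ftor"
  (infixr "\<odot>" 75) where
  "G \<odot> F = \<lparr>Src = Src F, Tgt = Tgt G,
     OMap = compose (Ob (Src F)) (OMap G) (OMap F),
     AMap = compose (Ar (Src F)) (AMap G) (AMap F)\<rparr>"

primrec functor_pow :: "('o, 'a, 'o, 'a) ftor \<Rightarrow> nat \<Rightarrow> ('o, 'a, 'o, 'a) ftor"
  (infixr "\<up>" 80) where
  "F \<up> 0 = id_functor (Src F)"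
| "F \<up> Suc n = F \<odot> F \<up> n"

record ('oa, 'aa, 'ob, 'ab) ntrans =
  NDom :: "('oa, 'aa, 'ob, 'ab) ftor"
  NCod :: "('oa, 'aa, 'ob, 'ab) ftor"
  At :: "'oa \<Rightarrow> 'ab"

locale is_ntrans =
  F: is_functor A B "NDom \<alpha>" + G: is_functor A B "NCod \<alpha>"
  for A :: "('oa, 'aa) cat" and B :: "('ob, 'ab) cat"
    and \<alpha> :: "('oa, 'aa, 'ob, 'ab) ntrans" +
  assumes At_ext: "At \<alpha> \<in> extensional (Ob A)"
    and At_in: "x \<in> Ob A \<Longrightarrow> At \<alpha> x \<in> hom B (OMap (NDom \<alpha>) x) (OMap (NCod \<alpha>) x)"
    and natural: "f \<in> hom A x y
      \<Longrightarrow> At \<alpha> y \<cdot>\<^bsub>B\<^esub> AMap (NDom \<alpha>) f = AMap (NCod \<alpha>) f \<cdot>\<^bsub>B\<^esub> At \<alpha> x"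

definition id_ntrans :: "('oa, 'aa, 'ob, 'ab) ftor \<Rightarrow> ('oa, 'aa, 'ob, 'ab) ntrans" where
  "id_ntrans F = \<lparr>NDom = F, NCod = F, At = (\<lambda>x\<in>Ob (Src F). Id (Tgt F) (OMap F x))\<rparr>"

definition vcomp ::
  "('oa, 'aa, 'ob, 'ab) ntrans \<Rightarrow> ('oa, 'aa, 'ob, 'ab) ntrans \<Rightarrow> ('oa, 'aa, 'ob, 'ab) ntrans"
  (infixr "\<bullet>" 60) where
  "\<beta> \<bullet> \<alpha> = \<lparr>NDom = NDom \<alpha>, NCod = NCod \<beta>,
     At = (\<lambda>x\<in>Ob (Src (NDom \<alpha>)). At \<beta> x \<cdot>\<^bsub>Tgt (NDom \<alpha>)\<^esub> At \<alpha> x)\<rparr>"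

text \<open>Whiskering: \<open>F \<triangleright> \<alpha>\<close> is $F\alpha$ and \<open>\<alpha> \<triangleleft> F\<close> is $\alpha F$;
  \<open>F \<triangleright> \<alpha> \<triangleleft> G\<close> parses as \<open>F \<triangleright> (\<alpha> \<triangleleft> G)\<close>.\<close>

definition whisker_left ::
  "('ob, 'ab, 'oc, 'ac) ftor \<Rightarrow> ('oa, 'aa, 'ob, 'ab) ntrans \<Rightarrow> ('oa, 'aa, 'oc, 'ac) ntrans"
  (infixr "\<triangleright>" 70) where
  "F \<triangleright> \<alpha> = \<lparr>NDom = F \<odot> NDom \<alpha>, NCod = F \<odot> NCod \<alpha>,
     At = (\<lambda>x\<in>Ob (Src (NDom \<alpha>)). AMap F (At \<alpha> x))\<rparr>"

definition whisker_right ::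
  "('ob, 'ab, 'oc, 'ac) ntrans \<Rightarrow> ('oa, 'aa, 'ob, 'ab) ftor \<Rightarrow> ('oa, 'aa, 'oc, 'ac) ntrans"
  (infixl "\<triangleleft>" 71) where
  "\<alpha> \<triangleleft> F = \<lparr>NDom = NDom \<alpha> \<odot> F, NCod = NCod \<alpha> \<odot> F,
     At = (\<lambda>x\<in>Ob (Src F). At \<alpha> (OMap F x))\<rparr>"

definition Fun_cat :: "('oa, 'aa) cat \<Rightarrow> ('ob, 'ab) cat
    \<Rightarrow> (('oa, 'aa, 'ob, 'ab) ftor, ('oa, 'aa, 'ob, 'ab) ntrans) cat" where
  "Fun_cat A B = \<lparr>Ob = {F. is_functor A B F}, Ar = {\<alpha>. is_ntrans A B \<alpha>},
     Dom = NDom, Cod = NCod, Id = id_ntrans, Comp = vcomp\<rparr>"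


section \<open>Simplicial, duplicial and cyclic objects\<close>

text \<open>\<open>face X n i\<close> is $d_i\colon X_n \to X_{n-1}$, meaningful only for $n \ge 1$ and
  $i \le n$; \<open>degen X n j\<close> is $s_j\colon X_n \to X_{n+1}$, meaningful only for $j \le n$.\<close>

record ('o, 'a) simplicial_data =
  cells :: "nat \<Rightarrow> 'o"
  face :: "nat \<Rightarrow> nat \<Rightarrow> 'a"
  degen :: "nat \<Rightarrow> nat \<Rightarrow> 'a"

record ('o, 'a) duplicial_data = "('o, 'a) simplicial_data" +
  cyc :: "nat \<Rightarrow> 'a"

locale simplicial_object = category C
  for C :: "('o, 'a) cat" +
  fixes X :: "('o, 'a, 'z) simplicial_data_scheme"
  assumes cells_in: "cells X n \<in> Ob C"
    and face_in: "i \<le> Suc n \<Longrightarrow> face X (Suc n) i \<in> hom C (cells X (Suc n)) (cells X n)"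
    and degen_in: "j \<le> n \<Longrightarrow> degen X n j \<in> hom C (cells X n) (cells X (Suc n))"
    and face_face: "\<lbrakk>i < j; j \<le> Suc (Suc n)\<rbrakk> \<Longrightarrow>
      face X (Suc n) i \<cdot>\<^bsub>C\<^esub> face X (Suc (Suc n)) j
        = face X (Suc n) (j - 1) \<cdot>\<^bsub>C\<^esub> face X (Suc (Suc n)) i"
    and degen_degen: "\<lbrakk>i \<le> j; j \<le> n\<rbrakk> \<Longrightarrow>
      degen X (Suc n) i \<cdot>\<^bsub>C\<^esub> degen X n j = degen X (Suc n) (Suc j) \<cdot>\<^bsub>C\<^esub> degen X n i"
    and face_degen_less: "\<lbrakk>i < j; j \<le> Suc n\<rbrakk> \<Longrightarrow>
      face X (Suc (Suc n)) i \<cdot>\<^bsub>C\<^esub> degen X (Suc n) j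
        = degen X n (j - 1) \<cdot>\<^bsub>C\<^esub> face X (Suc n) i"
    and face_degen_id: "\<lbrakk>j \<le> n; i = j \<or> i = Suc j\<rbrakk> \<Longrightarrow>
      face X (Suc n) i \<cdot>\<^bsub>C\<^esub> degen X n j = Id C (cells X n)"
    and face_degen_greater: "\<lbrakk>Suc j < i; i \<le> Suc (Suc n)\<rbrakk> \<Longrightarrow>
      face X (Suc (Suc n)) i \<cdot>\<^bsub>C\<^esub> degen X (Suc n) j
        = degen X n j \<cdot>\<^bsub>C\<^esub> face X (Suc n) (i - 1)"

locale duplicial_object = simplicial_object C X
  for C :: "('o, 'a) cat" and X :: "('o, 'a) duplicial_data" +
  assumes cyc_in: "cyc X n \<in> hom C (cells X n) (cells X n)"
    and face_cyc: "\<lbrakk>1 \<le> i; i \<le> Suc n\<rbrakk> \<Longrightarrow>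
      face X (Suc n) i \<cdot>\<^bsub>C\<^esub> cyc X (Suc n) = cyc X n \<cdot>\<^bsub>C\<^esub> face X (Suc n) (i - 1)"
    and face_0_cyc: "face X (Suc n) 0 \<cdot>\<^bsub>C\<^esub> cyc X (Suc n) = face X (Suc n) (Suc n)"
    and degen_cyc: "\<lbrakk>1 \<le> j; j \<le> n\<rbrakk> \<Longrightarrow>
      degen X n j \<cdot>\<^bsub>C\<^esub> cyc X n = cyc X (Suc n) \<cdot>\<^bsub>C\<^esub> degen X n (j - 1)"
    and degen_0_cyc:
      "degen X n 0 \<cdot>\<^bsub>C\<^esub> cyc X n = arr_pow C (cyc X (Suc n)) 2 \<cdot>\<^bsub>C\<^esub> degen X n n"

locale cyclic_object = duplicial_object +
  assumes cyc_pow: "arr_pow C (cyc X n) (n + 1) = Id C (cells X n)"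

locale simplicial_morphism =
  X: simplicial_object C X + X': simplicial_object C X'
  for C :: "('o, 'a) cat"
    and X :: "('o, 'a, 'z) simplicial_data_scheme"
    and X' :: "('o, 'a, 'z) simplicial_data_scheme" +
  fixes f :: "nat \<Rightarrow> 'a"
  assumes mor_in: "f n \<in> hom C (cells X n) (cells X' n)"
    and mor_face: "i \<le> Suc n \<Longrightarrow>
      f n \<cdot>\<^bsub>C\<^esub> face X (Suc n) i = face X' (Suc n) i \<cdot>\<^bsub>C\<^esub> f (Suc n)"
    and mor_degen: "j \<le> n \<Longrightarrow>
      f (Suc n) \<cdot>\<^bsub>C\<^esub> degen X n j = degen X' n j \<cdot>\<^bsub>C\<^esub> f n"

locale duplicial_morphism =
  X: duplicial_object C X + X': duplicial_object C X' + simplicial_morphism C X X' f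
  for C :: "('o, 'a) cat" and X X' :: "('o, 'a) duplicial_data" and f :: "nat \<Rightarrow> 'a" +
  assumes mor_cyc: "f n \<cdot>\<^bsub>C\<^esub> cyc X n = cyc X' n \<cdot>\<^bsub>C\<^esub> f n"

definition mor_comp :: "('o, 'a) cat \<Rightarrow> (nat \<Rightarrow> 'a) \<Rightarrow> (nat \<Rightarrow> 'a) \<Rightarrow> nat \<Rightarrow> 'a" where
  "mor_comp C g f = (\<lambda>n. g n \<cdot>\<^bsub>C\<^esub> f n)"

definition id_mor :: "('o, 'a) cat \<Rightarrow> ('o, 'a) duplicial_data \<Rightarrow> nat \<Rightarrow> 'a" where
  "id_mor C X = (\<lambda>n. Id C (cells X n))"


section \<open>Comonads, distributive laws and their coalgebras\<close>

locale comonad =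
  fixes B :: "('o, 'a) cat"
    and T :: "('o, 'a, 'o, 'a) ftor"
    and \<Delta> \<epsilon> :: "('o, 'a, 'o, 'a) ntrans"
  assumes endofunctor: "is_functor B B T"
    and comult_in: "\<Delta> \<in> hom (Fun_cat B B) T (T \<odot> T)"
    and counit_in: "\<epsilon> \<in> hom (Fun_cat B B) T (id_functor B)"
    and coassoc: "(T \<triangleright> \<Delta>) \<bullet> \<Delta> = (\<Delta> \<triangleleft> T) \<bullet> \<Delta>"
    and counit_left: "(\<epsilon> \<triangleleft> T) \<bullet> \<Delta> = id_ntrans T"
    and counit_right: "(T \<triangleright> \<epsilon>) \<bullet> \<Delta> = id_ntrans T"

locale comonad_distributive_law =
  TT: comonad B T \<Delta>T \<epsilon>T + SS: comonad B S \<Delta>S \<epsilon>S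
  for B :: "('o, 'a) cat"
    and T :: "('o, 'a, 'o, 'a) ftor" and \<Delta>T \<epsilon>T
    and S :: "('o, 'a, 'o, 'a) ftor" and \<Delta>S \<epsilon>S +
  fixes \<chi> :: "('o, 'a, 'o, 'a) ntrans"
  assumes chi_in: "\<chi> \<in> hom (Fun_cat B B) (T \<odot> S) (S \<odot> T)"
    and chi_counit_T: "(S \<triangleright> \<epsilon>T) \<bullet> \<chi> = \<epsilon>T \<triangleleft> S"
    and chi_comult_T: "(S \<triangleright> \<Delta>T) \<bullet> \<chi> = (\<chi> \<triangleleft> T) \<bullet> (T \<triangleright> \<chi>) \<bullet> (\<Delta>T \<triangleleft> S)"
    and chi_counit_S: "(\<epsilon>S \<triangleleft> T) \<bullet> \<chi> = T \<triangleright> \<epsilon>S"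
    and chi_comult_S: "(\<Delta>S \<triangleleft> T) \<bullet> \<chi> = (S \<triangleright> \<chi>) \<bullet> (\<chi> \<triangleleft> S) \<bullet> (T \<triangleright> \<Delta>S)"

locale right_coalgebra =
  comonad_distributive_law B T \<Delta>T \<epsilon>T S \<Delta>S \<epsilon>S \<chi>
  for B :: "('o, 'a) cat" and T \<Delta>T \<epsilon>T S \<Delta>S \<epsilon>S \<chi> +
  fixes Y :: "('oy, 'ay) cat"
    and M :: "('oy, 'ay, 'o, 'a) ftor"
    and \<rho> :: "('oy, 'ay, 'o, 'a) ntrans"
  assumes M_functor: "is_functor Y B M"
    and rho_in: "\<rho> \<in> hom (Fun_cat Y B) (T \<odot> M) (S \<odot> M)"
    and rho_counit: "(\<epsilon>S \<triangleleft> M) \<bullet> \<rho> = \<epsilon>T \<triangleleft> M"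
    and rho_comult: "(\<Delta>S \<triangleleft> M) \<bullet> \<rho> = (S \<triangleright> \<rho>) \<bullet> (\<chi> \<triangleleft> M) \<bullet> (T \<triangleright> \<rho>) \<bullet> (\<Delta>T \<triangleleft> M)"

locale left_coalgebra =
  comonad_distributive_law B T \<Delta>T \<epsilon>T S \<Delta>S \<epsilon>S \<chi>
  for B :: "('o, 'a) cat" and T \<Delta>T \<epsilon>T S \<Delta>S \<epsilon>S \<chi> +
  fixes Z :: "('oz, 'az) cat"
    and N :: "('o, 'a, 'oz, 'az) ftor"
    and lam :: "('o, 'a, 'oz, 'az) ntrans"
  assumes N_functor: "is_functor B Z N"
    and lam_in: "lam \<in> hom (Fun_cat B Z) (N \<odot> S) (N \<odot> T)"
    and lam_counit: "(N \<triangleright> \<epsilon>T) \<bullet> lam = N \<triangleright> \<epsilon>S"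
    and lam_comult:
      "(N \<triangleright> \<Delta>T) \<bullet> lam = (lam \<triangleleft> T) \<bullet> (N \<triangleright> \<chi>) \<bullet> (lam \<triangleleft> S) \<bullet> (N \<triangleright> \<Delta>S)"


section \<open>The duplicial functors and the comparison morphisms\<close>

text \<open>The two iterates of $\chi$: \<open>chi_T\<close> gives $T^n S \to S T^n$ and \<open>chi_S\<close> gives
  $T S^n \to S^n T$.\<close>

primrec chi_T :: "('o, 'a, 'o, 'a) ftor \<Rightarrow> ('o, 'a, 'o, 'a) ftor \<Rightarrow> ('o, 'a, 'o, 'a) ntrans
    \<Rightarrow> nat \<Rightarrow> ('o, 'a, 'o, 'a) ntrans" where
  "chi_T T S \<chi> 0 = id_ntrans S"
| "chi_T T S \<chi> (Suc n) = (\<chi> \<triangleleft> T \<up> n) \<bullet> (T \<triangleright> chi_T T S \<chi> n)"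

primrec chi_S :: "('o, 'a, 'o, 'a) ftor \<Rightarrow> ('o, 'a, 'o, 'a) ftor \<Rightarrow> ('o, 'a, 'o, 'a) ntrans
    \<Rightarrow> nat \<Rightarrow> ('o, 'a, 'o, 'a) ntrans" where
  "chi_S T S \<chi> 0 = id_ntrans T"
| "chi_S T S \<chi> (Suc n) = (S \<triangleright> chi_S T S \<chi> n) \<bullet> (\<chi> \<triangleleft> S \<up> n)"

definition t_T where
  "t_T T S \<chi> N lam M \<rho> n =
     (lam \<triangleleft> T \<up> n \<odot> M) \<bullet> (N \<triangleright> chi_T T S \<chi> n \<triangleleft> M) \<bullet> (N \<odot> T \<up> n \<triangleright> \<rho>)"

definition t_S where
  "t_S T S \<chi> N lam M \<rho> n =
     (N \<odot> S \<up> n \<triangleright> \<rho>) \<bullet> (N \<triangleright> chi_S T S \<chi> n \<triangleleft> M) \<bullet> (lam \<triangleleft> S \<up> n \<odot> M)"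

definition C_T where
  "C_T T \<Delta>T \<epsilon>T S \<chi> N lam M \<rho> =
     \<lparr>cells = (\<lambda>n. N \<odot> T \<up> (n + 1) \<odot> M),
      face = (\<lambda>n i. N \<odot> T \<up> i \<triangleright> \<epsilon>T \<triangleleft> T \<up> (n - i) \<odot> M),
      degen = (\<lambda>n j. N \<odot> T \<up> j \<triangleright> \<Delta>T \<triangleleft> T \<up> (n - j) \<odot> M),
      cyc = t_T T S \<chi> N lam M \<rho>\<rparr>"

definition C_S_op where
  "C_S_op T S \<Delta>S \<epsilon>S \<chi> N lam M \<rho> =
     \<lparr>cells = (\<lambda>n. N \<odot> S \<up> (n + 1) \<odot> M),
      face = (\<lambda>n i. N \<odot> S \<up> (n - i) \<triangleright> \<epsilon>S \<triangleleft> S \<up> i \<odot> M),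
      degen = (\<lambda>n j. N \<odot> S \<up> (n - j) \<triangleright> \<Delta>S \<triangleleft> S \<up> j \<odot> M),
      cyc = t_S T S \<chi> N lam M \<rho>\<rparr>"

primrec vcomp_upto :: "(nat \<Rightarrow> ('oa, 'aa, 'ob, 'ab) ntrans) \<Rightarrow> nat \<Rightarrow> ('oa, 'aa, 'ob, 'ab) ntrans"
where
  "vcomp_upto a 0 = a 0"
| "vcomp_upto a (Suc k) = a (Suc k) \<bullet> vcomp_upto a k"

definition r_step where
  "r_step T S \<chi> N M \<rho> n i =
     (N \<odot> S \<up> i \<triangleright> chi_T T S \<chi> (n - i) \<triangleleft> M) \<bullet> (N \<odot> S \<up> i \<odot> T \<up> (n - i) \<triangleright> \<rho>)"

definition R_mor where
  "R_mor T S \<chi> N M \<rho> n = vcomp_upto (r_step T S \<chi> N M \<rho> n) n"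

definition l_step where
  "l_step T S \<chi> N lam M n i =
     (N \<triangleright> chi_S T S \<chi> (n - i) \<triangleleft> T \<up> i \<odot> M) \<bullet> (lam \<triangleleft> S \<up> (n - i) \<odot> T \<up> i \<odot> M)"

definition L_mor where
  "L_mor T S \<chi> N lam M n = vcomp_upto (l_step T S \<chi> N lam M n) n"

end

theory Submission
  imports Defs
begin

text \<open>All functors in sight have the form $N S^k T^m M$. Let $r$ create an $S$ from the last $T$
  by $\rho$ and slide it to the left across $T^m$, and let $l$ turn the first $S$ into a $T$ by
  $\lambda$ and slide it to the right across $S^k$. Then $R_n = r^{n+1}$, $L_n = l^{n+1}$,
  $t^{\mathbb T} = l r$ and $t^{\mathbb S} = r l$. As $l$ and $r$ act at opposite ends, they commute
  on $N S^k T^m M$ with $k, m \ge 1$; hence $R t^{\mathbb T} = r^{n+1} l r = r l r^{n+1}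
  = t^{\mathbb S} R$ and $L R = l^{n+1} r^{n+1} = (l r)^{n+1} = (t^{\mathbb T})^{n+1}$.
  Reading all composites of functors backwards exchanges $T$ with $S$, $M$ with $N$ and $r$ with
  $l$, which gives the statements about $L$ and $R L$.\<close>

section \<open>Arrows composed by domain and codomain\<close>

lemma hom_iff: "f \<in> hom C x y \<longleftrightarrow> f \<in> Ar C \<and> Dom C f = x \<and> Cod C f = y"
  by (simp add: hom_def)

context category
begin

lemma Comp_arr [simp]:
  assumes "g \<in> Ar C" "f \<in> Ar C" "Dom C g = Cod C f"
  shows "g \<cdot>\<^bsub>C\<^esub> f \<in> Ar C" "Dom C (g \<cdot>\<^bsub>C\<^esub> f) = Dom C f" "Cod C (g \<cdot>\<^bsub>C\<^esub> f) = Cod C g"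
  using Comp_in[of g "Dom C g" "Cod C g" f "Dom C f"] assms by (auto simp: hom_iff)

lemma Comp_assoc [simp]:
  "\<lbrakk>h \<in> Ar C; g \<in> Ar C; f \<in> Ar C; Dom C h = Cod C g; Dom C g = Cod C f\<rbrakk>
    \<Longrightarrow> (h \<cdot>\<^bsub>C\<^esub> g) \<cdot>\<^bsub>C\<^esub> f = h \<cdot>\<^bsub>C\<^esub> (g \<cdot>\<^bsub>C\<^esub> f)"
  by (rule assoc) (auto simp: hom_iff)

lemma Id_arr [simp]:
  assumes "x \<in> Ob C"
  shows "Id C x \<in> Ar C" "Dom C (Id C x) = x" "Cod C (Id C x) = x"
  using Id_in[OF assms] by (auto simp: hom_iff)

lemma Comp_Id [simp]:
  "\<lbrakk>f \<in> Ar C; Cod C f = x\<rbrakk> \<Longrightarrow> Id C x \<cdot>\<^bsub>C\<^esub> f = f"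
  "\<lbrakk>f \<in> Ar C; Dom C f = x\<rbrakk> \<Longrightarrow> f \<cdot>\<^bsub>C\<^esub> Id C x = f"
  using Id_left[of f _ x] Id_right[of f x] by (auto simp: hom_iff)

lemma Comp_extend:
  assumes "g \<cdot>\<^bsub>C\<^esub> f = k" "g \<in> Ar C" "f \<in> Ar C" "h \<in> Ar C" "Dom C g = Cod C f" "Dom C f = Cod C h"
  shows "g \<cdot>\<^bsub>C\<^esub> (f \<cdot>\<^bsub>C\<^esub> h) = k \<cdot>\<^bsub>C\<^esub> h"
  using assms by (simp flip: Comp_assoc)

lemma Dom_Cod_Ob [simp]: "f \<in> Ar C \<Longrightarrow> Dom C f \<in> Ob C" "f \<in> Ar C \<Longrightarrow> Cod C f \<in> Ob C"
  by (simp_all add: Dom_in Cod_in)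

end

section \<open>Sliding letters across a word\<close>

text \<open>\<open>F k m\<close> stands for $N S^k T^m M$. The letters \<open>T\<close> are indexed by the number of
  \<open>T\<close>s to their left, the letters \<open>S\<close> by the number of \<open>S\<close>s to their right; with this
  convention reading words backwards is just swapping the two arguments of \<open>F\<close>, \<open>r\<close>, \<open>eT\<close>, \<dots>\<close>

locale sliding = category C
  for C :: "('o, 'a) cat" +
  fixes F :: "nat \<Rightarrow> nat \<Rightarrow> 'o" and r :: "nat \<Rightarrow> nat \<Rightarrow> 'a"
    and eT dT eS dS :: "nat \<Rightarrow> nat \<Rightarrow> nat \<Rightarrow> 'a"
  assumes F_in: "F k m \<in> Ob C"
    and r_in: "r k m \<in> hom C (F k (Suc m)) (F (Suc k) m)"
    and eT_in: "i \<le> m \<Longrightarrow> eT k m i \<in> hom C (F k (Suc m)) (F k m)"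
    and dT_in: "i \<le> m \<Longrightarrow> dT k m i \<in> hom C (F k (Suc m)) (F k (Suc (Suc m)))"
    and eS_in: "i \<le> k \<Longrightarrow> eS k m i \<in> hom C (F (Suc k) m) (F k m)"
    and dS_in: "i \<le> k \<Longrightarrow> dS k m i \<in> hom C (F (Suc k) m) (F (Suc (Suc k)) m)"
    and eT_r: "i \<le> m \<Longrightarrow> eT (Suc k) m i \<cdot>\<^bsub>C\<^esub> r k (Suc m) = r k m \<cdot>\<^bsub>C\<^esub> eT k (Suc m) i"
    and dT_r: "i \<le> m \<Longrightarrow>
      dT (Suc k) m i \<cdot>\<^bsub>C\<^esub> r k (Suc m) = r k (Suc (Suc m)) \<cdot>\<^bsub>C\<^esub> dT k (Suc m) i"
    and eS_0_r: "eS k m 0 \<cdot>\<^bsub>C\<^esub> r k m = eT k m m"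
    and dS_0_r: "dS k m 0 \<cdot>\<^bsub>C\<^esub> r k m = r (Suc k) m \<cdot>\<^bsub>C\<^esub> r k (Suc m) \<cdot>\<^bsub>C\<^esub> dT k m m"
    and eS_Suc_r: "i \<le> k \<Longrightarrow>
      eS (Suc k) m (Suc i) \<cdot>\<^bsub>C\<^esub> r (Suc k) m = r k m \<cdot>\<^bsub>C\<^esub> eS k (Suc m) i"
    and dS_Suc_r: "i \<le> k \<Longrightarrow>
      dS (Suc k) m (Suc i) \<cdot>\<^bsub>C\<^esub> r (Suc k) m = r (Suc (Suc k)) m \<cdot>\<^bsub>C\<^esub> dS k (Suc m) i"
begin

lemma arr [simp]:
  "F k m \<in> Ob C"
  "r k m \<in> Ar C" "Dom C (r k m) = F k (Suc m)" "Cod C (r k m) = F (Suc k) m"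
  "i \<le> m \<Longrightarrow> eT k m i \<in> Ar C" "i \<le> m \<Longrightarrow> Dom C (eT k m i) = F k (Suc m)"
  "i \<le> m \<Longrightarrow> Cod C (eT k m i) = F k m"
  "i \<le> m \<Longrightarrow> dT k m i \<in> Ar C" "i \<le> m \<Longrightarrow> Dom C (dT k m i) = F k (Suc m)"
  "i \<le> m \<Longrightarrow> Cod C (dT k m i) = F k (Suc (Suc m))"
  "i \<le> k \<Longrightarrow> eS k m i \<in> Ar C" "i \<le> k \<Longrightarrow> Dom C (eS k m i) = F (Suc k) m"
  "i \<le> k \<Longrightarrow> Cod C (eS k m i) = F k m"
  "i \<le> k \<Longrightarrow> dS k m i \<in> Ar C" "i \<le> k \<Longrightarrow> Dom C (dS k m i) = F (Suc k) m"
  "i \<le> k \<Longrightarrow> Cod C (dS k m i) = F (Suc (Suc k)) m"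
  using F_in r_in[of k m] eT_in[of i m k] dT_in[of i m k] eS_in[of i k m] dS_in[of i k m]
  by (auto simp: hom_iff)

primrec run :: "nat \<Rightarrow> nat \<Rightarrow> nat \<Rightarrow> 'a" where
  "run k 0 m = Id C (F k m)"
| "run k (Suc j) m = r (k + j) m \<cdot>\<^bsub>C\<^esub> run k j (Suc m)"

lemma run_arr [simp]:
  "run k j m \<in> Ar C \<and> Dom C (run k j m) = F k (m + j) \<and> Cod C (run k j m) = F (k + j) m"
  by (induction j arbitrary: m) auto

lemma run_add: "run k (a + b) m = run (k + a) b m \<cdot>\<^bsub>C\<^esub> run k a (m + b)"
  by (induction b arbitrary: m) (simp_all add: add.assoc)

lemma run_Suc_right: "run k (Suc j) m = run (Suc k) j m \<cdot>\<^bsub>C\<^esub> r k (m + j)"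
  using run_add[of k 1 j m] by simp

lemma eT_run: "i \<le> m \<Longrightarrow> eT (k + j) m i \<cdot>\<^bsub>C\<^esub> run k j (Suc m) = run k j m \<cdot>\<^bsub>C\<^esub> eT k (m + j) i"
proof (induction j arbitrary: m)
  case (Suc j)
  then show ?case by (simp add: Comp_extend[OF eT_r])
qed simp

lemma dT_run:
  "i \<le> m \<Longrightarrow> dT (k + j) m i \<cdot>\<^bsub>C\<^esub> run k j (Suc m) = run k j (Suc (Suc m)) \<cdot>\<^bsub>C\<^esub> dT k (m + j) i"
proof (induction j arbitrary: m)
  case (Suc j)
  then show ?case by (simp add: Comp_extend[OF dT_r])
qed simp

lemma eS_run:
  "i \<le> k \<Longrightarrow> eS (k + j) m (i + j) \<cdot>\<^bsub>C\<^esub> run (Suc k) j m = run k j m \<cdot>\<^bsub>C\<^esub> eS k (m + j) i"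
proof (induction j arbitrary: m)
  case (Suc j)
  then show ?case by (simp add: Comp_extend[OF eS_Suc_r])
qed simp

lemma dS_run:
  "i \<le> k \<Longrightarrow> dS (k + j) m (i + j) \<cdot>\<^bsub>C\<^esub> run (Suc k) j m
    = run (Suc (Suc k)) j m \<cdot>\<^bsub>C\<^esub> dS k (m + j) i"
proof (induction j arbitrary: m)
  case (Suc j)
  then show ?case by (simp add: Comp_extend[OF dS_Suc_r])
qed simp

text \<open>The letter \<open>T\<close> with index \<open>i\<close> turns into an \<open>S\<close> at the middle factor, and the last \<open>i\<close>
  steps put \<open>i\<close> letters \<open>S\<close> to its right.\<close>

lemma run_split: "run 0 (Suc (a + i)) 0 = run (Suc a) i 0 \<cdot>\<^bsub>C\<^esub> r a i \<cdot>\<^bsub>C\<^esub> run 0 a (Suc i)"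
  using run_add[of 0 "Suc a" i 0] by simp

lemma eS_run_all:
  assumes "i \<le> Suc n"
  shows "eS (Suc n) 0 i \<cdot>\<^bsub>C\<^esub> run 0 (Suc (Suc n)) 0 = run 0 (Suc n) 0 \<cdot>\<^bsub>C\<^esub> eT 0 (Suc n) i"
proof -
  obtain a where n: "Suc n = a + i" using assms by (metis le_add_diff_inverse2)
  have "eS (a + i) 0 i \<cdot>\<^bsub>C\<^esub> run 0 (Suc (a + i)) 0
    = run a i 0 \<cdot>\<^bsub>C\<^esub> eS a i 0 \<cdot>\<^bsub>C\<^esub> r a i \<cdot>\<^bsub>C\<^esub> run 0 a (Suc i)"
    unfolding run_split using Comp_extend[OF eS_run[of 0 a i 0]] by simp
  also have "\<dots> = run a i 0 \<cdot>\<^bsub>C\<^esub> run 0 a i \<cdot>\<^bsub>C\<^esub> eT 0 (i + a) i"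
    using eT_run[of i i 0 a] by (simp add: Comp_extend[OF eS_0_r])
  also have "\<dots> = run 0 (a + i) 0 \<cdot>\<^bsub>C\<^esub> eT 0 (a + i) i"
    by (simp add: run_add add.commute)
  finally show ?thesis unfolding n .
qed

lemma dS_run_all:
  assumes "i \<le> n"
  shows "dS n 0 i \<cdot>\<^bsub>C\<^esub> run 0 (Suc n) 0 = run 0 (Suc (Suc n)) 0 \<cdot>\<^bsub>C\<^esub> dT 0 n i"
proof -
  obtain a where n: "n = a + i" using assms by (metis le_add_diff_inverse2)
  have "dS (a + i) 0 i \<cdot>\<^bsub>C\<^esub> run 0 (Suc (a + i)) 0
    = run (Suc (Suc a)) i 0 \<cdot>\<^bsub>C\<^esub> dS a i 0 \<cdot>\<^bsub>C\<^esub> r a i \<cdot>\<^bsub>C\<^esub> run 0 a (Suc i)"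
    unfolding run_split using Comp_extend[OF dS_run[of 0 a i 0]] by simp
  also have "\<dots> = run (Suc (Suc a)) i 0 \<cdot>\<^bsub>C\<^esub> r (Suc a) i \<cdot>\<^bsub>C\<^esub> r a (Suc i)
      \<cdot>\<^bsub>C\<^esub> run 0 a (Suc (Suc i)) \<cdot>\<^bsub>C\<^esub> dT 0 (i + a) i"
    using dT_run[of i i 0 a] by (simp add: Comp_extend[OF dS_0_r])
  also have "\<dots> = run 0 (Suc (Suc (a + i))) 0 \<cdot>\<^bsub>C\<^esub> dT 0 (a + i) i"
    using run_add[of 0 "Suc (Suc a)" i 0] by (simp add: add.commute)
  finally show ?thesis unfolding n .
qed

end

definition sliding_data where
  "sliding_data C F r l e d =
     \<lparr>cells = (\<lambda>n. F 0 (Suc n)), face = e 0, degen = d 0, cyc = (\<lambda>n. l 0 n \<cdot>\<^bsub>C\<^esub> r 0 n)\<rparr>"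

lemma sliding_data_simps [simp]:
  "cells (sliding_data C F r l e d) n = F 0 (Suc n)"
  "face (sliding_data C F r l e d) n i = e 0 n i"
  "degen (sliding_data C F r l e d) n i = d 0 n i"
  "cyc (sliding_data C F r l e d) n = l 0 n \<cdot>\<^bsub>C\<^esub> r 0 n"
  by (simp_all add: sliding_data_def)

locale sliding_pair =
  R: sliding C F r eT dT eS dS +
  L: sliding C "\<lambda>k m. F m k" "\<lambda>k m. l m k" "\<lambda>k m. eS m k" "\<lambda>k m. dS m k"
    "\<lambda>k m. eT m k" "\<lambda>k m. dT m k"
  for C :: "('o, 'a) cat" and F r l eT dT eS dS +
  assumes exchange: "l (Suc k) m \<cdot>\<^bsub>C\<^esub> r (Suc k) m = r k (Suc m) \<cdot>\<^bsub>C\<^esub> l k (Suc m)"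
    and simplicial_T: "simplicial_object C (sliding_data C F r l eT dT)"
    and simplicial_S: "simplicial_object C (sliding_data C (\<lambda>k m. F m k) (\<lambda>k m. l m k)
      (\<lambda>k m. r m k) (\<lambda>k m. eS m k) (\<lambda>k m. dS m k))"
begin

abbreviation "XT \<equiv> sliding_data C F r l eT dT"

abbreviation "XS \<equiv> sliding_data C (\<lambda>k m. F m k) (\<lambda>k m. l m k) (\<lambda>k m. r m k)
  (\<lambda>k m. eS m k) (\<lambda>k m. dS m k)"

lemma flip: "sliding_pair C (\<lambda>k m. F m k) (\<lambda>k m. l m k) (\<lambda>k m. r m k)
    (\<lambda>k m. eS m k) (\<lambda>k m. dS m k) (\<lambda>k m. eT m k) (\<lambda>k m. dT m k)"
  by (intro sliding_pair.intro sliding_pair_axioms.intro)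
     (fact R.sliding_axioms L.sliding_axioms simplicial_T simplicial_S exchange[symmetric])+

lemma l_run: "l (k + j) m \<cdot>\<^bsub>C\<^esub> R.run (Suc k) j m = R.run k j (Suc m) \<cdot>\<^bsub>C\<^esub> l k (m + j)"
proof (induction j arbitrary: m)
  case (Suc j)
  then show ?case by (simp add: R.Comp_extend[OF exchange])
qed simp

lemma duplicial_T: "duplicial_object C XT"
proof (intro duplicial_object.intro duplicial_object_axioms.intro)
  show "simplicial_object C XT" by (fact simplicial_T)
  fix n i
  show "cyc XT n \<in> hom C (cells XT n) (cells XT n)" by (simp add: hom_iff)
  show "face XT (Suc n) i \<cdot>\<^bsub>C\<^esub> cyc XT (Suc n) = cyc XT n \<cdot>\<^bsub>C\<^esub> face XT (Suc n) (i - 1)"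
    if i: "1 \<le> i" "i \<le> Suc n"
  proof -
    obtain j where "i = Suc j" "j \<le> n" using i by (cases i) auto
    then show ?thesis using R.eT_r[of j n 0] by (simp add: R.Comp_extend[OF L.eS_Suc_r])
  qed
  show "face XT (Suc n) 0 \<cdot>\<^bsub>C\<^esub> cyc XT (Suc n) = face XT (Suc n) (Suc n)"
    by (simp add: R.Comp_extend[OF L.eS_0_r] R.eS_0_r)
  show "degen XT n i \<cdot>\<^bsub>C\<^esub> cyc XT n = cyc XT (Suc n) \<cdot>\<^bsub>C\<^esub> degen XT n (i - 1)"
    if i: "1 \<le> i" "i \<le> n"
  proof -
    obtain j n' where "i = Suc j" "j \<le> n'" "n = Suc n'" using i by (cases i; cases n) auto
    then show ?thesis using R.dT_r[of j n' 0] by (simp add: R.Comp_extend[OF L.dS_Suc_r])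
  qed
  show "degen XT n 0 \<cdot>\<^bsub>C\<^esub> cyc XT n = arr_pow C (cyc XT (Suc n)) 2 \<cdot>\<^bsub>C\<^esub> degen XT n n"
    by (simp add: R.Comp_extend[OF L.dS_0_r] R.dS_0_r R.Comp_extend[OF exchange]
        numeral_2_eq_2)
qed

lemma morphism: "duplicial_object C XS \<Longrightarrow> duplicial_morphism C XT XS (\<lambda>n. R.run 0 (Suc n) 0)"
proof (intro duplicial_morphism.intro simplicial_morphism.intro simplicial_morphism_axioms.intro
    duplicial_morphism_axioms.intro simplicial_T simplicial_S duplicial_T)
  fix n i
  show "R.run 0 (Suc n) 0 \<in> hom C (cells XT n) (cells XS n)" by (simp add: hom_iff)
  show "i \<le> Suc n \<Longrightarrow> R.run 0 (Suc n) 0 \<cdot>\<^bsub>C\<^esub> face XT (Suc n) i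
      = face XS (Suc n) i \<cdot>\<^bsub>C\<^esub> R.run 0 (Suc (Suc n)) 0"
    using R.eS_run_all[of i n] by simp
  show "i \<le> n \<Longrightarrow> R.run 0 (Suc (Suc n)) 0 \<cdot>\<^bsub>C\<^esub> degen XT n i
      = degen XS n i \<cdot>\<^bsub>C\<^esub> R.run 0 (Suc n) 0"
    using R.dS_run_all[of i n] by simp
  have "l n 0 \<cdot>\<^bsub>C\<^esub> R.run 0 (Suc n) 0 = R.run 0 n 1 \<cdot>\<^bsub>C\<^esub> l 0 n \<cdot>\<^bsub>C\<^esub> r 0 n"
    using R.Comp_extend[OF l_run[of 0 n 0]] by (simp add: R.run_Suc_right del: R.run.simps)
  then show "R.run 0 (Suc n) 0 \<cdot>\<^bsub>C\<^esub> cyc XT n = cyc XS n \<cdot>\<^bsub>C\<^esub> R.run 0 (Suc n) 0"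
    by simp
qed

lemma pow_cyc:
  "Suc n = m + j \<Longrightarrow> arr_pow C (cyc XT n) j = L.run m j 0 \<cdot>\<^bsub>C\<^esub> R.run 0 j m"
proof (induction j arbitrary: m)
  case (Suc j)
  interpret flip: sliding_pair C "\<lambda>k m. F m k" "\<lambda>k m. l m k" "\<lambda>k m. r m k"
    "\<lambda>k m. eS m k" "\<lambda>k m. dS m k" "\<lambda>k m. eT m k" "\<lambda>k m. dT m k"
    by (fact flip)
  have n: "n = m + j" using Suc.prems by simp
  have "arr_pow C (cyc XT n) (Suc j)
    = l 0 n \<cdot>\<^bsub>C\<^esub> r 0 n \<cdot>\<^bsub>C\<^esub> L.run (Suc m) j 0 \<cdot>\<^bsub>C\<^esub> R.run 0 j (Suc m)"
    using Suc.IH[of "Suc m"] n by simp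
  also have "\<dots> = l 0 n \<cdot>\<^bsub>C\<^esub> L.run m j 1 \<cdot>\<^bsub>C\<^esub> r j m \<cdot>\<^bsub>C\<^esub> R.run 0 j (Suc m)"
    by (simp add: n R.Comp_extend[OF flip.l_run[where k = m and j = j and m = 0]])
  finally show ?case by (simp add: n)
qed simp

lemma cyclic_iff:
  assumes "\<And>n. f n = L.run 0 (Suc n) 0" "\<And>n. g n = R.run 0 (Suc n) 0"
  shows "mor_comp C f g = id_mor C XT \<longleftrightarrow> cyclic_object C XT"
proof -
  have "mor_comp C f g n = arr_pow C (cyc XT n) (n + 1)" for n
    using pow_cyc[of n 0 "Suc n"] assms by (simp only: mor_comp_def) simp
  then show ?thesis
    using duplicial_T
    by (simp only: cyclic_object_def cyclic_object_axioms_def id_mor_def fun_eq_iff) simp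
qed

end

section \<open>Calculus of functors and natural transformations\<close>

context is_functor
begin

lemma functor_simps [simp]:
  "Src F = A" "Tgt F = B"
  "x \<in> Ob A \<Longrightarrow> OMap F x \<in> Ob B"
  "x \<in> Ob A \<Longrightarrow> AMap F (Id A x) = Id B (OMap F x)"
  using Src_eq Tgt_eq OMap_in AMap_Id by auto

lemma AMap_arr [simp]:
  assumes "f \<in> Ar A"
  shows "AMap F f \<in> Ar B" "Dom B (AMap F f) = OMap F (Dom A f)" "Cod B (AMap F f) = OMap F (Cod A f)"
  using AMap_in[of f "Dom A f" "Cod A f"] assms by (auto simp: hom_iff)

lemma AMap_comp [simp]:
  "\<lbrakk>g \<in> Ar A; f \<in> Ar A; Dom A g = Cod A f\<rbrakk>
    \<Longrightarrow> AMap F (g \<cdot>\<^bsub>A\<^esub> f) = AMap F g \<cdot>\<^bsub>B\<^esub> AMap F f"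
  by (rule AMap_Comp) (auto simp: hom_iff)

end

lemma functor_eqI:
  fixes F G :: "('oa, 'aa, 'ob, 'ab) ftor"
  assumes "is_functor A B F" "is_functor A B G"
    and "\<And>x. x \<in> Ob A \<Longrightarrow> OMap F x = OMap G x"
    and "\<And>f. f \<in> Ar A \<Longrightarrow> AMap F f = AMap G f"
  shows "F = G"
proof -
  interpret F: is_functor A B F by fact
  interpret G: is_functor A B G by fact
  have "OMap F = OMap G"
    using F.OMap_in G.OMap_in assms(3)
    by (intro extensionalityI[where A = "Ob A"]) (auto simp: PiE_def)
  moreover have "AMap F = AMap G"
    using F.AMap_ext G.AMap_ext assms(4) by (intro extensionalityI[where A = "Ar A"]) auto
  ultimately show ?thesis by (intro ftor.equality) simp_all
qed

lemma functor_comp_simps [simp]: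
  "Src (G \<odot> F) = Src F" "Tgt (G \<odot> F) = Tgt G"
  "x \<in> Ob (Src F) \<Longrightarrow> OMap (G \<odot> F) x = OMap G (OMap F x)"
  "f \<in> Ar (Src F) \<Longrightarrow> AMap (G \<odot> F) f = AMap G (AMap F f)"
  by (simp_all add: functor_comp_def compose_def)

lemma id_functor_simps [simp]:
  "Src (id_functor A) = A" "Tgt (id_functor A) = A"
  "x \<in> Ob A \<Longrightarrow> OMap (id_functor A) x = x"
  "f \<in> Ar A \<Longrightarrow> AMap (id_functor A) f = f"
  by (simp_all add: id_functor_def)

lemma is_functor_id: "category A \<Longrightarrow> is_functor A A (id_functor A)"
proof -
  assume "category A"
  then interpret category A .
  show ?thesis
    by unfold_locales (auto simp: hom_iff, simp_all add: id_functor_def)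
qed

lemma is_functor_comp:
  assumes "is_functor B C G" "is_functor A B F"
  shows "is_functor A C (G \<odot> F)"
proof -
  interpret G: is_functor B C G by fact
  interpret F: is_functor A B F by fact
  show ?thesis
    by unfold_locales (auto simp: hom_iff, simp_all add: functor_comp_def compose_def)
qed

lemma functor_comp_assoc:
  assumes "is_functor C D H" "is_functor B C G" "is_functor A B F"
  shows "(H \<odot> G) \<odot> F = H \<odot> G \<odot> F"
proof -
  interpret H: is_functor C D H by fact
  interpret G: is_functor B C G by fact
  interpret F: is_functor A B F by fact
  show ?thesis
    by (rule functor_eqI) (auto intro: is_functor_comp assms)
qed

lemma functor_comp_id:
  assumes "is_functor A B F"
  shows "id_functor B \<odot> F = F" "F \<odot> id_functor A = F"
proof -
  interpret F: is_functor A B F by fact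
  show "id_functor B \<odot> F = F" "F \<odot> id_functor A = F"
    by (auto intro!: functor_eqI[OF is_functor_comp]
        intro: is_functor_id assms F.A.category_axioms F.B.category_axioms)
qed

lemma Fun_cat_simps [simp]:
  "Ob (Fun_cat A B) = {F. is_functor A B F}" "Ar (Fun_cat A B) = {\<alpha>. is_ntrans A B \<alpha>}"
  "Dom (Fun_cat A B) = NDom" "Cod (Fun_cat A B) = NCod"
  "Id (Fun_cat A B) = id_ntrans" "Comp (Fun_cat A B) = vcomp"
  by (simp_all add: Fun_cat_def)

lemma hom_Fun_iff:
  "\<alpha> \<in> hom (Fun_cat A B) F G \<longleftrightarrow> is_ntrans A B \<alpha> \<and> NDom \<alpha> = F \<and> NCod \<alpha> = G"
  by (simp add: hom_def Fun_cat_def)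

lemma hom_FunI:
  assumes "is_functor A B F" "is_functor A B G"
    and "NDom \<alpha> = F" "NCod \<alpha> = G" "At \<alpha> \<in> extensional (Ob A)"
    and "\<And>x. x \<in> Ob A \<Longrightarrow> At \<alpha> x \<in> hom B (OMap F x) (OMap G x)"
    and "\<And>f. f \<in> Ar A
      \<Longrightarrow> At \<alpha> (Cod A f) \<cdot>\<^bsub>B\<^esub> AMap F f = AMap G f \<cdot>\<^bsub>B\<^esub> At \<alpha> (Dom A f)"
  shows "\<alpha> \<in> hom (Fun_cat A B) F G"
  unfolding hom_Fun_iff using assms by (auto simp: is_ntrans_def is_ntrans_axioms_def hom_iff)

lemma hom_Fun_functors:
  "\<alpha> \<in> hom (Fun_cat A B) F G \<Longrightarrow> is_functor A B F"
  "\<alpha> \<in> hom (Fun_cat A B) F G \<Longrightarrow> is_functor A B G"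
  by (auto simp: hom_Fun_iff is_ntrans_def)

lemma hom_Fun_At:
  assumes "\<alpha> \<in> hom (Fun_cat A B) F G"
  shows "NDom \<alpha> = F" "NCod \<alpha> = G" "At \<alpha> \<in> extensional (Ob A)"
    and "x \<in> Ob A \<Longrightarrow> At \<alpha> x \<in> Ar B"
    and "x \<in> Ob A \<Longrightarrow> Dom B (At \<alpha> x) = OMap F x"
    and "x \<in> Ob A \<Longrightarrow> Cod B (At \<alpha> x) = OMap G x"
proof -
  interpret is_ntrans A B \<alpha> using assms by (simp add: hom_Fun_iff)
  show "NDom \<alpha> = F" "NCod \<alpha> = G" "At \<alpha> \<in> extensional (Ob A)"
    "x \<in> Ob A \<Longrightarrow> At \<alpha> x \<in> Ar B"
    "x \<in> Ob A \<Longrightarrow> Dom B (At \<alpha> x) = OMap F x"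
    "x \<in> Ob A \<Longrightarrow> Cod B (At \<alpha> x) = OMap G x"
    using assms At_ext At_in[of x] by (auto simp: hom_Fun_iff hom_iff)
qed

lemma hom_Fun_natural:
  assumes "\<alpha> \<in> hom (Fun_cat A B) F G" "f \<in> Ar A" "Cod A f = y"
  shows "At \<alpha> y \<cdot>\<^bsub>B\<^esub> AMap F f = AMap G f \<cdot>\<^bsub>B\<^esub> At \<alpha> (Dom A f)"
proof -
  interpret is_ntrans A B \<alpha> using assms by (simp add: hom_Fun_iff)
  show ?thesis using natural[of f "Dom A f" y] assms by (simp add: hom_Fun_iff hom_iff)
qed

lemma ntrans_eqI:
  fixes \<alpha> \<beta> :: "('oa, 'aa, 'ob, 'ab) ntrans"
  assumes "\<alpha> \<in> hom (Fun_cat A B) F G" "\<beta> \<in> hom (Fun_cat A B) F G"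
    and "\<And>x. x \<in> Ob A \<Longrightarrow> At \<alpha> x = At \<beta> x"
  shows "\<alpha> = \<beta>"
proof -
  have "At \<alpha> = At \<beta>"
    using hom_Fun_At[OF assms(1)] hom_Fun_At[OF assms(2)] assms(3)
    by (intro extensionalityI[where A = "Ob A"]) auto
  then show ?thesis
    using hom_Fun_At[OF assms(1)] hom_Fun_At[OF assms(2)] by (intro ntrans.equality) simp_all
qed

lemma ntrans_eqI':
  fixes \<alpha> \<beta> :: "('oa, 'aa, 'ob, 'ab) ntrans"
  assumes "is_ntrans A B \<alpha>" "is_ntrans A B \<beta>" "NDom \<alpha> = NDom \<beta>" "NCod \<alpha> = NCod \<beta>"
    and "\<And>x. x \<in> Ob A \<Longrightarrow> At \<alpha> x = At \<beta> x"
  shows "\<alpha> = \<beta>"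
  by (rule ntrans_eqI[of _ A B "NDom \<alpha>" "NCod \<alpha>"]) (simp_all add: hom_Fun_iff assms)

lemma ntrans_simps [simp]:
  "NDom (id_ntrans F) = F" "NCod (id_ntrans F) = F"
  "NDom (\<beta> \<bullet> \<alpha>) = NDom \<alpha>" "NCod (\<beta> \<bullet> \<alpha>) = NCod \<beta>"
  "NDom (H \<triangleright> \<alpha>) = H \<odot> NDom \<alpha>" "NCod (H \<triangleright> \<alpha>) = H \<odot> NCod \<alpha>"
  "NDom (\<alpha> \<triangleleft> K) = NDom \<alpha> \<odot> K" "NCod (\<alpha> \<triangleleft> K) = NCod \<alpha> \<odot> K"
  "u \<in> Ob (Src F) \<Longrightarrow> At (id_ntrans F) u = Id (Tgt F) (OMap F u)"
  "x \<in> Ob (Src (NDom \<alpha>)) \<Longrightarrow> At (\<beta> \<bullet> \<alpha>) x = At \<beta> x \<cdot>\<^bsub>Tgt (NDom \<alpha>)\<^esub> At \<alpha> x"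
  "x \<in> Ob (Src (NDom \<alpha>)) \<Longrightarrow> At (H \<triangleright> \<alpha>) x = AMap H (At \<alpha> x)"
  "y \<in> Ob (Src K) \<Longrightarrow> At (\<alpha> \<triangleleft> K) y = At \<alpha> (OMap K y)"
  by (simp_all add: id_ntrans_def vcomp_def whisker_left_def whisker_right_def)

lemma At_extensional [simp]:
  "At (id_ntrans F) \<in> extensional (Ob (Src F))"
  "At (\<beta> \<bullet> \<alpha>) \<in> extensional (Ob (Src (NDom \<alpha>)))"
  "At (H \<triangleright> \<alpha>) \<in> extensional (Ob (Src (NDom \<alpha>)))"
  "At (\<alpha> \<triangleleft> K) \<in> extensional (Ob (Src K))"
  by (simp_all add: id_ntrans_def vcomp_def whisker_left_def whisker_right_def)

lemma id_ntrans_in: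
  assumes "is_functor A B F"
  shows "id_ntrans F \<in> hom (Fun_cat A B) F F"
proof -
  interpret is_functor A B F by fact
  show ?thesis
    using At_extensional(1)[of F] by (intro hom_FunI assms) (auto simp: hom_iff)
qed

lemma vcomp_in:
  assumes "\<beta> \<in> hom (Fun_cat A B) G H" "\<alpha> \<in> hom (Fun_cat A B) F G"
  shows "\<beta> \<bullet> \<alpha> \<in> hom (Fun_cat A B) F H"
proof -
  interpret F: is_functor A B F using assms(2) by (rule hom_Fun_functors)
  interpret G: is_functor A B G using assms(2) by (rule hom_Fun_functors)
  interpret H: is_functor A B H using assms(1) by (rule hom_Fun_functors)
  note [simp] = hom_Fun_At[OF assms(1)] hom_Fun_At[OF assms(2)]
  show ?thesis
  proof (rule hom_FunI[OF F.is_functor_axioms H.is_functor_axioms])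
    show "At (\<beta> \<bullet> \<alpha>) \<in> extensional (Ob A)" using At_extensional(2)[of \<beta> \<alpha>] by simp
    fix f assume f: "f \<in> Ar A"
    show "At (\<beta> \<bullet> \<alpha>) (Cod A f) \<cdot>\<^bsub>B\<^esub> AMap F f
        = AMap H f \<cdot>\<^bsub>B\<^esub> At (\<beta> \<bullet> \<alpha>) (Dom A f)"
      using f F.B.Comp_extend[OF hom_Fun_natural[OF assms(1) f refl], of "At \<alpha> (Dom A f)"]
      by (simp add: hom_Fun_natural[OF assms(2)])
  qed (simp_all add: hom_iff)
qed

lemma is_ntrans_vcomp [simp]:
  "\<lbrakk>is_ntrans A B \<beta>; is_ntrans A B \<alpha>; NDom \<beta> = NCod \<alpha>\<rbrakk> \<Longrightarrow> is_ntrans A B (\<beta> \<bullet> \<alpha>)"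
  using vcomp_in[of \<beta> A B "NCod \<alpha>" "NCod \<beta>" \<alpha> "NDom \<alpha>"] by (simp add: hom_Fun_iff)

lemma whisker_left_in:
  assumes "is_functor B C H" "\<alpha> \<in> hom (Fun_cat A B) F G"
  shows "H \<triangleright> \<alpha> \<in> hom (Fun_cat A C) (H \<odot> F) (H \<odot> G)"
proof -
  interpret F: is_functor A B F using assms(2) by (rule hom_Fun_functors)
  interpret G: is_functor A B G using assms(2) by (rule hom_Fun_functors)
  interpret H: is_functor B C H by fact
  note [simp] = hom_Fun_At[OF assms(2)]
  show ?thesis
  proof (rule hom_FunI)
    show "At (H \<triangleright> \<alpha>) \<in> extensional (Ob A)" using At_extensional(3)[of H \<alpha>] by simp
    fix f assume f: "f \<in> Ar A"
    then show "At (H \<triangleright> \<alpha>) (Cod A f) \<cdot>\<^bsub>C\<^esub> AMap (H \<odot> F) f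
        = AMap (H \<odot> G) f \<cdot>\<^bsub>C\<^esub> At (H \<triangleright> \<alpha>) (Dom A f)"
      by (simp add: hom_Fun_natural[OF assms(2)] flip: H.AMap_comp)
  qed (auto simp: hom_iff intro: is_functor_comp F.is_functor_axioms G.is_functor_axioms assms(1))
qed

lemma whisker_right_in:
  assumes "\<alpha> \<in> hom (Fun_cat B C) F G" "is_functor A B K"
  shows "\<alpha> \<triangleleft> K \<in> hom (Fun_cat A C) (F \<odot> K) (G \<odot> K)"
proof -
  interpret F: is_functor B C F using assms(1) by (rule hom_Fun_functors)
  interpret G: is_functor B C G using assms(1) by (rule hom_Fun_functors)
  interpret K: is_functor A B K by fact
  note [simp] = hom_Fun_At[OF assms(1)]
  show ?thesis
  proof (rule hom_FunI)
    show "At (\<alpha> \<triangleleft> K) \<in> extensional (Ob A)" using At_extensional(4)[of \<alpha> K] by simp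
  qed (auto simp: hom_iff hom_Fun_natural[OF assms(1)]
      intro: is_functor_comp F.is_functor_axioms G.is_functor_axioms assms(2))
qed

lemma category_Fun_cat: "category (Fun_cat A B)"
proof (unfold_locales, simp_all add: id_ntrans_in vcomp_in)
  show "is_functor A B (NDom \<alpha>)" "is_functor A B (NCod \<alpha>)" if "is_ntrans A B \<alpha>" for \<alpha>
    using that by (auto simp: is_ntrans_def)
next
  fix \<alpha> :: "('a, 'b, 'c, 'd) ntrans" and F G
  assume \<alpha>: "\<alpha> \<in> hom (Fun_cat A B) F G"
  note [simp] = hom_Fun_At[OF \<alpha>]
  interpret F: is_functor A B F using \<alpha> by (rule hom_Fun_functors)
  interpret G: is_functor A B G using \<alpha> by (rule hom_Fun_functors)
  show "id_ntrans G \<bullet> \<alpha> = \<alpha>"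
    by (rule ntrans_eqI[OF vcomp_in[OF id_ntrans_in \<alpha>] \<alpha>]) (auto simp: G.is_functor_axioms)
  show "\<alpha> \<bullet> id_ntrans F = \<alpha>"
    by (rule ntrans_eqI[OF vcomp_in[OF \<alpha> id_ntrans_in] \<alpha>]) (auto simp: F.is_functor_axioms)
next
  fix \<alpha> \<beta> \<gamma> :: "('a, 'b, 'c, 'd) ntrans" and F G H K
  assume \<gamma>: "\<gamma> \<in> hom (Fun_cat A B) H K" and \<beta>: "\<beta> \<in> hom (Fun_cat A B) G H"
    and \<alpha>: "\<alpha> \<in> hom (Fun_cat A B) F G"
  note [simp] = hom_Fun_At[OF \<alpha>] hom_Fun_At[OF \<beta>] hom_Fun_At[OF \<gamma>]
  interpret F: is_functor A B F using \<alpha> by (rule hom_Fun_functors)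
  interpret G: is_functor A B G using \<alpha> by (rule hom_Fun_functors)
  show "(\<gamma> \<bullet> \<beta>) \<bullet> \<alpha> = \<gamma> \<bullet> \<beta> \<bullet> \<alpha>"
    by (rule ntrans_eqI[OF vcomp_in[OF vcomp_in[OF \<gamma> \<beta>] \<alpha>] vcomp_in[OF \<gamma> vcomp_in[OF \<beta> \<alpha>]]])
       auto
qed

lemma hom_Fun_cong:
  "\<lbrakk>\<alpha> \<in> hom (Fun_cat A B) F G; F = F'; G = G'\<rbrakk> \<Longrightarrow> \<alpha> \<in> hom (Fun_cat A B) F' G'"
  by simp

lemma whisker_left_vcomp:
  assumes H: "is_functor B C H" and \<beta>: "\<beta> \<in> hom (Fun_cat A B) G K" and \<alpha>: "\<alpha> \<in> hom (Fun_cat A B) F G"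
  shows "H \<triangleright> (\<beta> \<bullet> \<alpha>) = (H \<triangleright> \<beta>) \<bullet> (H \<triangleright> \<alpha>)"
proof (rule ntrans_eqI)
  interpret H: is_functor B C H by fact
  interpret F: is_functor A B F using \<alpha> by (rule hom_Fun_functors)
  interpret G: is_functor A B G using \<alpha> by (rule hom_Fun_functors)
  show "H \<triangleright> (\<beta> \<bullet> \<alpha>) \<in> hom (Fun_cat A C) (H \<odot> F) (H \<odot> K)"
    by (rule whisker_left_in vcomp_in assms)+
  show "(H \<triangleright> \<beta>) \<bullet> (H \<triangleright> \<alpha>) \<in> hom (Fun_cat A C) (H \<odot> F) (H \<odot> K)"
    by (rule vcomp_in whisker_left_in assms)+
  show "At (H \<triangleright> (\<beta> \<bullet> \<alpha>)) x = At ((H \<triangleright> \<beta>) \<bullet> (H \<triangleright> \<alpha>)) x" if "x \<in> Ob A" for x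
    using that by (simp add: hom_Fun_At[OF \<alpha>] hom_Fun_At[OF \<beta>])
qed

lemma whisker_right_vcomp:
  assumes K: "is_functor A B K" and \<beta>: "\<beta> \<in> hom (Fun_cat B C) G H" and \<alpha>: "\<alpha> \<in> hom (Fun_cat B C) F G"
  shows "(\<beta> \<bullet> \<alpha>) \<triangleleft> K = (\<beta> \<triangleleft> K) \<bullet> (\<alpha> \<triangleleft> K)"
proof (rule ntrans_eqI)
  interpret K: is_functor A B K by fact
  interpret F: is_functor B C F using \<alpha> by (rule hom_Fun_functors)
  show "(\<beta> \<bullet> \<alpha>) \<triangleleft> K \<in> hom (Fun_cat A C) (F \<odot> K) (H \<odot> K)"
    by (rule whisker_right_in vcomp_in assms)+
  show "(\<beta> \<triangleleft> K) \<bullet> (\<alpha> \<triangleleft> K) \<in> hom (Fun_cat A C) (F \<odot> K) (H \<odot> K)"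
    by (rule vcomp_in whisker_right_in assms)+
  show "At ((\<beta> \<bullet> \<alpha>) \<triangleleft> K) x = At ((\<beta> \<triangleleft> K) \<bullet> (\<alpha> \<triangleleft> K)) x" if "x \<in> Ob A" for x
    using that by (simp add: hom_Fun_At[OF \<alpha>] hom_Fun_At[OF \<beta>])
qed

lemma whisker_left_comp:
  assumes H: "is_functor C D H" and G: "is_functor B C G" and \<alpha>: "\<alpha> \<in> hom (Fun_cat A B) F K"
  shows "(H \<odot> G) \<triangleright> \<alpha> = H \<triangleright> G \<triangleright> \<alpha>"
proof (rule ntrans_eqI)
  interpret H: is_functor C D H by fact
  interpret G: is_functor B C G by fact
  note F = hom_Fun_functors[OF \<alpha>]
  interpret F: is_functor A B F by (rule F)
  show "H \<triangleright> G \<triangleright> \<alpha> \<in> hom (Fun_cat A D) (H \<odot> G \<odot> F) (H \<odot> G \<odot> K)"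
    by (rule whisker_left_in assms)+
  show "(H \<odot> G) \<triangleright> \<alpha> \<in> hom (Fun_cat A D) (H \<odot> G \<odot> F) (H \<odot> G \<odot> K)"
    unfolding functor_comp_assoc[OF H G F(1), symmetric] functor_comp_assoc[OF H G F(2), symmetric]
    by (rule whisker_left_in is_functor_comp assms)+
  show "At ((H \<odot> G) \<triangleright> \<alpha>) x = At (H \<triangleright> G \<triangleright> \<alpha>) x" if "x \<in> Ob A" for x
    using that by (simp add: hom_Fun_At[OF \<alpha>])
qed

lemma whisker_right_comp:
  assumes G: "is_functor B C G" and K: "is_functor A B K" and \<alpha>: "\<alpha> \<in> hom (Fun_cat C D) F H"
  shows "\<alpha> \<triangleleft> (G \<odot> K) = \<alpha> \<triangleleft> G \<triangleleft> K"
proof (rule ntrans_eqI)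
  interpret G: is_functor B C G by fact
  interpret K: is_functor A B K by fact
  note F = hom_Fun_functors[OF \<alpha>]
  show "\<alpha> \<triangleleft> (G \<odot> K) \<in> hom (Fun_cat A D) (F \<odot> G \<odot> K) (H \<odot> G \<odot> K)"
    by (rule whisker_right_in is_functor_comp assms)+
  show "\<alpha> \<triangleleft> G \<triangleleft> K \<in> hom (Fun_cat A D) (F \<odot> G \<odot> K) (H \<odot> G \<odot> K)"
    unfolding functor_comp_assoc[OF F(1) G K, symmetric] functor_comp_assoc[OF F(2) G K, symmetric]
    by (rule whisker_right_in assms)+
  show "At (\<alpha> \<triangleleft> (G \<odot> K)) x = At (\<alpha> \<triangleleft> G \<triangleleft> K) x" if "x \<in> Ob A" for x
    using that by simp
qed

lemma whisker_left_right:
  assumes H: "is_functor C D H" and K: "is_functor A B K" and \<alpha>: "\<alpha> \<in> hom (Fun_cat B C) F G"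
  shows "(H \<triangleright> \<alpha>) \<triangleleft> K = H \<triangleright> \<alpha> \<triangleleft> K"
proof (rule ntrans_eqI)
  interpret H: is_functor C D H by fact
  interpret K: is_functor A B K by fact
  note F = hom_Fun_functors[OF \<alpha>]
  interpret F: is_functor B C F by (rule F)
  show "H \<triangleright> \<alpha> \<triangleleft> K \<in> hom (Fun_cat A D) (H \<odot> F \<odot> K) (H \<odot> G \<odot> K)"
    by (rule whisker_left_in whisker_right_in assms)+
  show "(H \<triangleright> \<alpha>) \<triangleleft> K \<in> hom (Fun_cat A D) (H \<odot> F \<odot> K) (H \<odot> G \<odot> K)"
    unfolding functor_comp_assoc[OF H F(1) K, symmetric] functor_comp_assoc[OF H F(2) K, symmetric]
    by (rule whisker_right_in whisker_left_in assms)+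
  show "At ((H \<triangleright> \<alpha>) \<triangleleft> K) x = At (H \<triangleright> \<alpha> \<triangleleft> K) x" if "x \<in> Ob A" for x
    using that by (simp add: hom_Fun_At[OF \<alpha>])
qed

lemma run_eq_vcomp_upto:
  assumes "sliding (Fun_cat A B) F r eT dT eS dS" and f: "\<And>i. i \<le> n \<Longrightarrow> f i = r i (n - i)"
  shows "j \<le> n \<Longrightarrow> sliding.run (Fun_cat A B) F r 0 (Suc j) (n - j) = vcomp_upto f j"
proof -
  interpret sliding "Fun_cat A B" F r eT dT eS dS by fact
  show "j \<le> n \<Longrightarrow> run 0 (Suc j) (n - j) = vcomp_upto f j"
  proof (induction j)
    case 0
    then show ?case using f[of 0] Comp_Id(2)[of "r 0 n"] arr[of 0 n] by (simp del: arr)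
  next
    case (Suc j)
    then show ?case using f[of "Suc j"] by (simp add: Suc_diff_Suc)
  qed
qed

section \<open>The bar construction of a comonad\<close>

context comonad
begin

sublocale T: is_functor B B T
  by (fact endofunctor)

lemma pow_functor: "is_functor B B (T \<up> n)"
  by (induction n) (auto intro: is_functor_id is_functor_comp endofunctor T.A.category_axioms)

sublocale Tn: is_functor B B "T \<up> n" for n
  by (fact pow_functor)

lemma pow_OMap [simp]:
  assumes "x \<in> Ob B"
  shows "OMap (T \<up> n) (OMap T x) = OMap T (OMap (T \<up> n) x)"
    and "OMap (T \<up> (m + n)) x = OMap (T \<up> m) (OMap (T \<up> n) x)"
proof -
  show "OMap (T \<up> n) (OMap T x) = OMap T (OMap (T \<up> n) x)"
    using assms by (induction n) auto
  show "OMap (T \<up> (m + n)) x = OMap (T \<up> m) (OMap (T \<up> n) x)"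
    using assms by (induction m) auto
qed

lemma pow_AMap [simp]:
  assumes "f \<in> Ar B"
  shows "AMap (T \<up> n) (AMap T f) = AMap T (AMap (T \<up> n) f)"
    and "AMap (T \<up> (m + n)) f = AMap (T \<up> m) (AMap (T \<up> n) f)"
proof -
  show "AMap (T \<up> n) (AMap T f) = AMap T (AMap (T \<up> n) f)"
    using assms by (induction n) auto
  show "AMap (T \<up> (m + n)) f = AMap (T \<up> m) (AMap (T \<up> n) f)"
    using assms by (induction m) auto
qed

lemma At_arr [simp]:
  "NDom \<Delta> = T" "NCod \<Delta> = T \<odot> T" "NDom \<epsilon> = T" "NCod \<epsilon> = id_functor B"
  "x \<in> Ob B \<Longrightarrow> At \<Delta> x \<in> Ar B"
  "x \<in> Ob B \<Longrightarrow> Dom B (At \<Delta> x) = OMap T x"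
  "x \<in> Ob B \<Longrightarrow> Cod B (At \<Delta> x) = OMap T (OMap T x)"
  "x \<in> Ob B \<Longrightarrow> At \<epsilon> x \<in> Ar B"
  "x \<in> Ob B \<Longrightarrow> Dom B (At \<epsilon> x) = OMap T x"
  "x \<in> Ob B \<Longrightarrow> Cod B (At \<epsilon> x) = x"
  using hom_Fun_At[OF comult_in] hom_Fun_At[OF counit_in] by auto

lemma counit_natural:
  "\<lbrakk>f \<in> Ar B; Cod B f = y\<rbrakk> \<Longrightarrow> At \<epsilon> y \<cdot>\<^bsub>B\<^esub> AMap T f = f \<cdot>\<^bsub>B\<^esub> At \<epsilon> (Dom B f)"
  using hom_Fun_natural[OF counit_in] by simp

lemma comult_natural:
  "\<lbrakk>f \<in> Ar B; Cod B f = y\<rbrakk>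
    \<Longrightarrow> At \<Delta> y \<cdot>\<^bsub>B\<^esub> AMap T f = AMap T (AMap T f) \<cdot>\<^bsub>B\<^esub> At \<Delta> (Dom B f)"
  using hom_Fun_natural[OF comult_in] by simp

lemma comonad_At:
  assumes "x \<in> Ob B"
  shows "AMap T (At \<Delta> x) \<cdot>\<^bsub>B\<^esub> At \<Delta> x = At \<Delta> (OMap T x) \<cdot>\<^bsub>B\<^esub> At \<Delta> x"
    and "At \<epsilon> (OMap T x) \<cdot>\<^bsub>B\<^esub> At \<Delta> x = Id B (OMap T x)"
    and "AMap T (At \<epsilon> x) \<cdot>\<^bsub>B\<^esub> At \<Delta> x = Id B (OMap T x)"
  using assms arg_cong[OF coassoc, of "\<lambda>\<alpha>. At \<alpha> x"] arg_cong[OF counit_left, of "\<lambda>\<alpha>. At \<alpha> x"]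
    arg_cong[OF counit_right, of "\<lambda>\<alpha>. At \<alpha> x"]
  by simp_all

end

locale comonad_context = comonad B T \<Delta> \<epsilon> + N: is_functor B Z N + M: is_functor Y B M
  for B :: "('o, 'a) cat" and T \<Delta> \<epsilon>
    and Z :: "('oz, 'az) cat" and N :: "('o, 'a, 'oz, 'az) ftor"
    and Y :: "('oy, 'ay) cat" and M :: "('oy, 'ay, 'o, 'a) ftor"
begin

lemmas functors = is_functor_comp endofunctor pow_functor is_functor_id[OF T.A.category_axioms]
  N.is_functor_axioms M.is_functor_axioms

definition eps :: "nat \<Rightarrow> nat \<Rightarrow> ('oy, 'ay, 'oz, 'az) ntrans" where
  "eps i c = N \<odot> T \<up> i \<triangleright> \<epsilon> \<triangleleft> T \<up> c \<odot> M"

definition delta :: "nat \<Rightarrow> nat \<Rightarrow> ('oy, 'ay, 'oz, 'az) ntrans" where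
  "delta i c = N \<odot> T \<up> i \<triangleright> \<Delta> \<triangleleft> T \<up> c \<odot> M"

lemma eps_in: "eps i c \<in> hom (Fun_cat Y Z) (N \<odot> T \<up> Suc (i + c) \<odot> M) (N \<odot> T \<up> (i + c) \<odot> M)"
proof -
  have "eps i c \<in> hom (Fun_cat Y Z) ((N \<odot> T \<up> i) \<odot> T \<odot> T \<up> c \<odot> M)
      ((N \<odot> T \<up> i) \<odot> id_functor B \<odot> T \<up> c \<odot> M)"
    unfolding eps_def by (rule whisker_left_in whisker_right_in counit_in functors)+
  moreover have "(N \<odot> T \<up> i) \<odot> T \<odot> T \<up> c \<odot> M = N \<odot> T \<up> Suc (i + c) \<odot> M"
    "(N \<odot> T \<up> i) \<odot> id_functor B \<odot> T \<up> c \<odot> M = N \<odot> T \<up> (i + c) \<odot> M"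
    by (rule functor_eqI, (rule functors)+, simp_all)+
  ultimately show ?thesis by simp
qed

lemma delta_in:
  "delta i c \<in> hom (Fun_cat Y Z) (N \<odot> T \<up> Suc (i + c) \<odot> M) (N \<odot> T \<up> Suc (Suc (i + c)) \<odot> M)"
proof -
  have "delta i c \<in> hom (Fun_cat Y Z) ((N \<odot> T \<up> i) \<odot> T \<odot> T \<up> c \<odot> M)
      ((N \<odot> T \<up> i) \<odot> (T \<odot> T) \<odot> T \<up> c \<odot> M)"
    unfolding delta_def by (rule whisker_left_in whisker_right_in comult_in functors)+
  moreover have "(N \<odot> T \<up> i) \<odot> T \<odot> T \<up> c \<odot> M = N \<odot> T \<up> Suc (i + c) \<odot> M"
    "(N \<odot> T \<up> i) \<odot> (T \<odot> T) \<odot> T \<up> c \<odot> M = N \<odot> T \<up> Suc (Suc (i + c)) \<odot> M"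
    by (rule functor_eqI, (rule functors)+, simp_all)+
  ultimately show ?thesis by simp
qed

lemma eps_delta_simps [simp]:
  "is_ntrans Y Z (eps i c)" "NDom (eps i c) = N \<odot> T \<up> Suc (i + c) \<odot> M"
  "NCod (eps i c) = N \<odot> T \<up> (i + c) \<odot> M"
  "is_ntrans Y Z (delta i c)" "NDom (delta i c) = N \<odot> T \<up> Suc (i + c) \<odot> M"
  "NCod (delta i c) = N \<odot> T \<up> Suc (Suc (i + c)) \<odot> M"
  "y \<in> Ob Y \<Longrightarrow> At (eps i c) y = AMap N (AMap (T \<up> i) (At \<epsilon> (OMap (T \<up> c) (OMap M y))))"
  "y \<in> Ob Y \<Longrightarrow> At (delta i c) y = AMap N (AMap (T \<up> i) (At \<Delta> (OMap (T \<up> c) (OMap M y))))"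
  using eps_in[of i c] delta_in[of i c] unfolding hom_Fun_iff
  by (simp_all add: eps_def delta_def)

lemma eps_eps: "eps i (b + c) \<bullet> eps (Suc (i + b)) c = eps (i + b) c \<bullet> eps i (Suc (b + c))"
proof (rule ntrans_eqI'[of Y Z])
  fix y assume y: "y \<in> Ob Y"
  show "At (eps i (b + c) \<bullet> eps (Suc (i + b)) c) y = At (eps (i + b) c \<bullet> eps i (Suc (b + c))) y"
    using y arg_cong[OF counit_natural[of "AMap (T \<up> b) (At \<epsilon> (OMap (T \<up> c) (OMap M y)))", OF _ refl],
        of "\<lambda>f. AMap N (AMap (T \<up> i) f)"]
    by simp
qed (simp_all add: ac_simps)

lemma eps_delta_less: "eps i (Suc (Suc (b + c))) \<bullet> delta (Suc (i + b)) c = delta (i + b) c \<bullet> eps i (Suc (b + c))"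
proof (rule ntrans_eqI'[of Y Z])
  fix y assume y: "y \<in> Ob Y"
  show "At (eps i (Suc (Suc (b + c))) \<bullet> delta (Suc (i + b)) c) y
    = At (delta (i + b) c \<bullet> eps i (Suc (b + c))) y"
    using y arg_cong[OF counit_natural[of "AMap (T \<up> b) (At \<Delta> (OMap (T \<up> c) (OMap M y)))", OF _ refl],
        of "\<lambda>f. AMap N (AMap (T \<up> i) f)"]
    by simp
qed (simp_all add: ac_simps)

lemma delta_delta: "i \<le> j \<Longrightarrow> j \<le> n \<Longrightarrow>
  delta i (Suc n - i) \<bullet> delta j (n - j) = delta (Suc j) (n - j) \<bullet> delta i (n - i)"
proof (rule ntrans_eqI'[of Y Z])
  fix y assume ij: "i \<le> j" "j \<le> n" and y: "y \<in> Ob Y"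
  obtain c where n: "n = j + c" using ij by (metis le_add_diff_inverse)
  consider "j = i" | b where "j = Suc (i + b)" using ij by (metis le_eq_less_or_eq less_iff_Suc_add)
  then show "At (delta i (Suc n - i) \<bullet> delta j (n - j)) y
    = At (delta (Suc j) (n - j) \<bullet> delta i (n - i)) y"
  proof cases
    case 1
    then show ?thesis
      using y arg_cong[OF comonad_At(1)[of "OMap (T \<up> c) (OMap M y)"],
          of "\<lambda>f. AMap N (AMap (T \<up> i) f)"] n
      by simp
  next
    case 2
    then show ?thesis
      using y arg_cong[OF comult_natural[of "AMap (T \<up> b) (At \<Delta> (OMap (T \<up> c) (OMap M y)))", OF _ refl],
          of "\<lambda>f. AMap N (AMap (T \<up> i) f)"] n
      by simp
  qed
qed (simp_all add: ac_simps)

lemma eps_delta_greater: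
  "eps (Suc (Suc (i + b))) c \<bullet> delta i (Suc (b + c)) = delta i (b + c) \<bullet> eps (Suc (i + b)) c"
proof (rule ntrans_eqI'[of Y Z])
  fix y assume y: "y \<in> Ob Y"
  show "At (eps (Suc (Suc (i + b))) c \<bullet> delta i (Suc (b + c))) y
    = At (delta i (b + c) \<bullet> eps (Suc (i + b)) c) y"
    using y arg_cong[OF comult_natural[of "AMap (T \<up> b) (At \<epsilon> (OMap (T \<up> c) (OMap M y)))", OF _ refl],
        of "\<lambda>f. AMap N (AMap (T \<up> i) f)"]
    by simp
qed (simp_all add: ac_simps)

lemma eps_delta_id:
  "eps i (Suc c) \<bullet> delta i c = id_ntrans (N \<odot> T \<up> Suc (i + c) \<odot> M)"
  "eps (Suc i) c \<bullet> delta i c = id_ntrans (N \<odot> T \<up> Suc (i + c) \<odot> M)"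
proof -
  have id: "is_ntrans Y Z (id_ntrans (N \<odot> T \<up> Suc (i + c) \<odot> M))"
    using id_ntrans_in[of Y Z "N \<odot> T \<up> Suc (i + c) \<odot> M"] eps_in hom_Fun_functors hom_Fun_iff by metis
  show "eps i (Suc c) \<bullet> delta i c = id_ntrans (N \<odot> T \<up> Suc (i + c) \<odot> M)"
  proof (rule ntrans_eqI'[of Y Z, OF _ id])
    fix y assume y: "y \<in> Ob Y"
    show "At (eps i (Suc c) \<bullet> delta i c) y = At (id_ntrans (N \<odot> T \<up> Suc (i + c) \<odot> M)) y"
      using y arg_cong[OF comonad_At(2)[of "OMap (T \<up> c) (OMap M y)"],
          of "\<lambda>f. AMap N (AMap (T \<up> i) f)"]
      by simp
  qed simp_all
  show "eps (Suc i) c \<bullet> delta i c = id_ntrans (N \<odot> T \<up> Suc (i + c) \<odot> M)"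
  proof (rule ntrans_eqI'[of Y Z, OF _ id])
    fix y assume y: "y \<in> Ob Y"
    show "At (eps (Suc i) c \<bullet> delta i c) y = At (id_ntrans (N \<odot> T \<up> Suc (i + c) \<odot> M)) y"
      using y arg_cong[OF comonad_At(3)[of "OMap (T \<up> c) (OMap M y)"],
          of "\<lambda>f. AMap N (AMap (T \<up> i) f)"]
      by simp
  qed simp_all
qed

lemma simplicial_bar:
  assumes cells: "\<And>n. cells X n = N \<odot> T \<up> Suc n \<odot> M"
    and face: "\<And>n i. i \<le> n \<Longrightarrow> face X n i = eps i (n - i)"
    and degen: "\<And>n i. i \<le> n \<Longrightarrow> degen X n i = delta i (n - i)"
  shows "simplicial_object (Fun_cat Y Z) X"
proof (intro simplicial_object.intro simplicial_object_axioms.intro category_Fun_cat,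
    unfold Fun_cat_simps)
  fix n i j
  show "cells X n \<in> {F. is_functor Y Z F}"
    using hom_Fun_functors(1)[OF eps_in[of 0 n]] by (simp add: cells)
  show "face X (Suc n) i \<in> hom (Fun_cat Y Z) (cells X (Suc n)) (cells X n)" if "i \<le> Suc n"
    using eps_in[of i "Suc n - i"] that by (simp add: cells face)
  show "degen X n j \<in> hom (Fun_cat Y Z) (cells X n) (cells X (Suc n))" if "j \<le> n"
    using delta_in[of j "n - j"] that by (simp add: cells degen)
  show "face X (Suc n) i \<bullet> face X (Suc (Suc n)) j = face X (Suc n) (j - 1) \<bullet> face X (Suc (Suc n)) i"
    if ij: "i < j" "j \<le> Suc (Suc n)"
  proof -
    obtain b where b: "j = Suc (i + b)" using less_imp_Suc_add[OF ij(1)] by auto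
    then show ?thesis using eps_eps[of i b "Suc n - (i + b)"] ij by (simp add: face Suc_diff_le)
  qed
  show "degen X (Suc n) i \<bullet> degen X n j = degen X (Suc n) (Suc j) \<bullet> degen X n i"
    if "i \<le> j" "j \<le> n"
    using that delta_delta[of i j n] by (simp add: degen)
  show "face X (Suc (Suc n)) i \<bullet> degen X (Suc n) j = degen X n (j - 1) \<bullet> face X (Suc n) i"
    if ij: "i < j" "j \<le> Suc n"
  proof -
    obtain b where b: "j = Suc (i + b)" using less_imp_Suc_add[OF ij(1)] by auto
    then show ?thesis using eps_delta_less[of i b "n - (i + b)"] ij
      by (simp add: face degen Suc_diff_le)
  qed
  show "face X (Suc n) i \<bullet> degen X n j = id_ntrans (cells X n)" if "j \<le> n" "i = j \<or> i = Suc j"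
    using that eps_delta_id[of j "n - j"] by (auto simp: cells face degen Suc_diff_le)
  show "face X (Suc (Suc n)) i \<bullet> degen X (Suc n) j = degen X n j \<bullet> face X (Suc n) (i - 1)"
    if ij: "Suc j < i" "i \<le> Suc (Suc n)"
  proof -
    obtain b where b: "i = Suc (Suc j + b)" using less_imp_Suc_add[OF ij(1)] by auto
    then show ?thesis using eps_delta_greater[of j b "n - (j + b)"] ij
      by (simp add: face degen Suc_diff_le)
  qed
qed

end

lemma simplicial_object_reverse:
  assumes "simplicial_object C X"
    and cells: "\<And>n. cells X' n = cells X n"
    and face: "\<And>n i. i \<le> n \<Longrightarrow> face X' n i = face X n (n - i)"
    and degen: "\<And>n i. i \<le> n \<Longrightarrow> degen X' n i = degen X n (n - i)"
  shows "simplicial_object C X'"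
proof -
  interpret simplicial_object C X by fact
  show ?thesis
  proof (intro simplicial_object.intro simplicial_object_axioms.intro category_axioms)
    fix n i j
    show "cells X' n \<in> Ob C" by (simp add: cells cells_in)
    show "face X' (Suc n) i \<in> hom C (cells X' (Suc n)) (cells X' n)" if "i \<le> Suc n"
      using that by (simp add: cells face face_in)
    show "degen X' n j \<in> hom C (cells X' n) (cells X' (Suc n))" if "j \<le> n"
      using that by (simp add: cells degen degen_in)
    show "face X' (Suc n) i \<cdot>\<^bsub>C\<^esub> face X' (Suc (Suc n)) j
        = face X' (Suc n) (j - 1) \<cdot>\<^bsub>C\<^esub> face X' (Suc (Suc n)) i"
      if "i < j" "j \<le> Suc (Suc n)"
      using that face_face[of "Suc (Suc n) - j" "Suc (Suc n) - i" n]
      by (simp add: face Suc_diff_le)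
    show "degen X' (Suc n) i \<cdot>\<^bsub>C\<^esub> degen X' n j
        = degen X' (Suc n) (Suc j) \<cdot>\<^bsub>C\<^esub> degen X' n i"
      if "i \<le> j" "j \<le> n"
      using that degen_degen[of "n - j" "n - i" n] by (simp add: degen Suc_diff_le)
    show "face X' (Suc (Suc n)) i \<cdot>\<^bsub>C\<^esub> degen X' (Suc n) j
        = degen X' n (j - 1) \<cdot>\<^bsub>C\<^esub> face X' (Suc n) i"
      if "i < j" "j \<le> Suc n"
      using that face_degen_greater[of "Suc n - j" "Suc (Suc n) - i" n]
      by (simp add: face degen Suc_diff_le)
    show "face X' (Suc n) i \<cdot>\<^bsub>C\<^esub> degen X' n j = Id C (cells X' n)"
      if "j \<le> n" "i = j \<or> i = Suc j"
      using that face_degen_id[of "n - j" n "Suc n - i"] by (auto simp: cells face degen Suc_diff_le)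
    show "face X' (Suc (Suc n)) i \<cdot>\<^bsub>C\<^esub> degen X' (Suc n) j
        = degen X' n j \<cdot>\<^bsub>C\<^esub> face X' (Suc n) (i - 1)"
      if "Suc j < i" "i \<le> Suc (Suc n)"
      using that face_degen_less[of "Suc (Suc n) - i" "Suc n - j" n]
      by (simp add: face degen Suc_diff_le)
  qed
qed

section \<open>Coalgebras over a distributive law\<close>

context comonad_distributive_law
begin

lemmas chi_At [simp] = hom_Fun_At[OF chi_in]

lemma chi_natural:
  "\<lbrakk>f \<in> Ar B; Cod B f = y\<rbrakk>
    \<Longrightarrow> At \<chi> y \<cdot>\<^bsub>B\<^esub> AMap T (AMap S f) = AMap S (AMap T f) \<cdot>\<^bsub>B\<^esub> At \<chi> (Dom B f)"
  using hom_Fun_natural[OF chi_in, of f y] by simp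

lemma chi_laws:
  assumes x: "x \<in> Ob B"
  shows "AMap S (At \<epsilon>T x) \<cdot>\<^bsub>B\<^esub> At \<chi> x = At \<epsilon>T (OMap S x)"
    and "AMap S (At \<Delta>T x) \<cdot>\<^bsub>B\<^esub> At \<chi> x
      = At \<chi> (OMap T x) \<cdot>\<^bsub>B\<^esub> AMap T (At \<chi> x) \<cdot>\<^bsub>B\<^esub> At \<Delta>T (OMap S x)"
    and "At \<epsilon>S (OMap T x) \<cdot>\<^bsub>B\<^esub> At \<chi> x = AMap T (At \<epsilon>S x)"
    and "At \<Delta>S (OMap T x) \<cdot>\<^bsub>B\<^esub> At \<chi> x
      = AMap S (At \<chi> x) \<cdot>\<^bsub>B\<^esub> At \<chi> (OMap S x) \<cdot>\<^bsub>B\<^esub> AMap T (At \<Delta>S x)"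
  using x arg_cong[OF chi_counit_T, of "\<lambda>\<alpha>. At \<alpha> x"] arg_cong[OF chi_comult_T, of "\<lambda>\<alpha>. At \<alpha> x"]
    arg_cong[OF chi_counit_S, of "\<lambda>\<alpha>. At \<alpha> x"] arg_cong[OF chi_comult_S, of "\<lambda>\<alpha>. At \<alpha> x"]
  by simp_all

lemmas naturality = chi_natural TT.counit_natural TT.comult_natural SS.counit_natural SS.comult_natural
lemmas naturality_simps = naturality naturality[THEN TT.T.A.Comp_extend]
  chi_laws chi_laws[THEN TT.T.A.Comp_extend]

lemmas B_functors = is_functor_comp TT.endofunctor TT.pow_functor SS.endofunctor SS.pow_functor
  is_functor_id[OF TT.T.A.category_axioms]

lemma chi_T_in: "chi_T T S \<chi> n \<in> hom (Fun_cat B B) (T \<up> n \<odot> S) (S \<odot> T \<up> n)"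
proof (induction n)
  case 0
  have "id_ntrans S \<in> hom (Fun_cat B B) S S" by (rule id_ntrans_in SS.endofunctor)+
  then show ?case
    using functor_comp_id[OF SS.endofunctor] by simp
next
  case (Suc n)
  have "chi_T T S \<chi> (Suc n) \<in> hom (Fun_cat B B) (T \<odot> T \<up> n \<odot> S) ((S \<odot> T) \<odot> T \<up> n)"
    unfolding chi_T.simps
    by (rule vcomp_in[OF _ hom_Fun_cong[OF whisker_left_in[OF _ Suc] refl]],
        (rule whisker_right_in chi_in B_functors)+, rule functor_comp_assoc[symmetric],
        (rule B_functors)+)
  then show ?case
    by (rule hom_Fun_cong) (simp, rule functor_comp_assoc[symmetric] functor_comp_assoc, (rule B_functors)+)+
qed

lemma chi_S_in: "chi_S T S \<chi> n \<in> hom (Fun_cat B B) (T \<odot> S \<up> n) (S \<up> n \<odot> T)"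
proof (induction n)
  case 0
  have "id_ntrans T \<in> hom (Fun_cat B B) T T" by (rule id_ntrans_in TT.endofunctor)+
  then show ?case
    using functor_comp_id[OF TT.endofunctor] by simp
next
  case (Suc n)
  have "chi_S T S \<chi> (Suc n) \<in> hom (Fun_cat B B) ((T \<odot> S) \<odot> S \<up> n) (S \<odot> S \<up> n \<odot> T)"
    unfolding chi_S.simps
    by (rule vcomp_in[OF hom_Fun_cong[OF whisker_left_in[OF _ Suc] _ refl]],
        (rule B_functors)+, rule functor_comp_assoc[symmetric], (rule B_functors)+,
        (rule whisker_right_in chi_in B_functors)+)
  then show ?case
    by (rule hom_Fun_cong) (simp, rule functor_comp_assoc[symmetric] functor_comp_assoc, (rule B_functors)+)+
qed

lemmas chi_pow_At [simp] = hom_Fun_At[OF chi_T_in] hom_Fun_At[OF chi_S_in]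

lemma chi_S_Suc:
  "x \<in> Ob B \<Longrightarrow> At (chi_S T S \<chi> (Suc n)) x
    = AMap (S \<up> n) (At \<chi> x) \<cdot>\<^bsub>B\<^esub> At (chi_S T S \<chi> n) (OMap S x)"
proof (induction n)
  case (Suc n)
  have "At (chi_S T S \<chi> (Suc (Suc n))) x
    = AMap S (At (chi_S T S \<chi> (Suc n)) x) \<cdot>\<^bsub>B\<^esub> At \<chi> (OMap (S \<up> Suc n) x)"
    unfolding chi_S.simps(2)[of _ _ _ "Suc n"] using Suc.prems by (simp del: chi_S.simps)
  also have "\<dots> = AMap (S \<up> Suc n) (At \<chi> x) \<cdot>\<^bsub>B\<^esub> At (chi_S T S \<chi> (Suc n)) (OMap S x)"
    unfolding Suc.IH[OF Suc.prems] using Suc.prems by simp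
  finally show ?case .
qed simp

end

locale coalgebra_pair =
  right_coalgebra B T \<Delta>T \<epsilon>T S \<Delta>S \<epsilon>S \<chi> Y M \<rho> + left_coalgebra B T \<Delta>T \<epsilon>T S \<Delta>S \<epsilon>S \<chi> Z N lam
  for B :: "('o, 'a) cat" and T \<Delta>T \<epsilon>T S \<Delta>S \<epsilon>S \<chi>
    and Y :: "('oy, 'ay) cat" and M \<rho> and Z :: "('oz, 'az) cat" and N lam
begin

sublocale N: is_functor B Z N by (fact N_functor)

sublocale M: is_functor Y B M by (fact M_functor)

lemmas functors = B_functors N_functor M_functor

sublocale CT: comonad_context B T \<Delta>T \<epsilon>T Z "N \<odot> S \<up> k" Y M for k
  by (intro comonad_context.intro TT.comonad_axioms M_functor) (rule functors)+

sublocale CS: comonad_context B S \<Delta>S \<epsilon>S Z N Y "T \<up> m \<odot> M" for m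
  by (intro comonad_context.intro SS.comonad_axioms N_functor) (rule functors)+

lemmas coalgebra_At [simp] = hom_Fun_At[OF rho_in] hom_Fun_At[OF lam_in]

lemma rho_laws:
  assumes "y \<in> Ob Y"
  shows "At \<epsilon>S (OMap M y) \<cdot>\<^bsub>B\<^esub> At \<rho> y = At \<epsilon>T (OMap M y)"
    and "At \<Delta>S (OMap M y) \<cdot>\<^bsub>B\<^esub> At \<rho> y
      = AMap S (At \<rho> y) \<cdot>\<^bsub>B\<^esub> At \<chi> (OMap M y) \<cdot>\<^bsub>B\<^esub> AMap T (At \<rho> y)
        \<cdot>\<^bsub>B\<^esub> At \<Delta>T (OMap M y)"
  using assms arg_cong[OF rho_counit, of "\<lambda>\<alpha>. At \<alpha> y"] arg_cong[OF rho_comult, of "\<lambda>\<alpha>. At \<alpha> y"]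
  by simp_all

lemma lam_laws:
  assumes "x \<in> Ob B"
  shows "AMap N (At \<epsilon>T x) \<cdot>\<^bsub>Z\<^esub> At lam x = AMap N (At \<epsilon>S x)"
    and "AMap N (At \<Delta>T x) \<cdot>\<^bsub>Z\<^esub> At lam x
      = At lam (OMap T x) \<cdot>\<^bsub>Z\<^esub> AMap N (At \<chi> x) \<cdot>\<^bsub>Z\<^esub> At lam (OMap S x)
        \<cdot>\<^bsub>Z\<^esub> AMap N (At \<Delta>S x)"
  using assms arg_cong[OF lam_counit, of "\<lambda>\<alpha>. At \<alpha> x"] arg_cong[OF lam_comult, of "\<lambda>\<alpha>. At \<alpha> x"]
  by simp_all

definition rho_pow :: "nat \<Rightarrow> ('oy, 'ay, 'o, 'a) ntrans" where
  "rho_pow n = (chi_T T S \<chi> n \<triangleleft> M) \<bullet> (T \<up> n \<triangleright> \<rho>)"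

definition lam_pow :: "nat \<Rightarrow> ('o, 'a, 'oz, 'az) ntrans" where
  "lam_pow k = (N \<triangleright> chi_S T S \<chi> k) \<bullet> (lam \<triangleleft> S \<up> k)"

lemma rho_pow_in: "rho_pow n \<in> hom (Fun_cat Y B) (T \<up> Suc n \<odot> M) (S \<odot> T \<up> n \<odot> M)"
proof -
  have "rho_pow n \<in> hom (Fun_cat Y B) (T \<up> n \<odot> T \<odot> M) ((S \<odot> T \<up> n) \<odot> M)"
    unfolding rho_pow_def
    by (rule vcomp_in[OF _ hom_Fun_cong[OF whisker_left_in[OF _ rho_in] refl]],
        (rule whisker_right_in chi_T_in functors)+, rule functor_comp_assoc[symmetric],
        (rule functors)+)
  moreover have "T \<up> n \<odot> T \<odot> M = T \<up> Suc n \<odot> M"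
    by (rule functor_eqI, (rule functors)+, simp_all)
  ultimately show ?thesis
    using functor_comp_assoc[OF SS.endofunctor TT.pow_functor M_functor] by simp
qed

lemma lam_pow_in: "lam_pow k \<in> hom (Fun_cat B Z) (N \<odot> S \<up> Suc k) (N \<odot> S \<up> k \<odot> T)"
proof -
  have "lam_pow k \<in> hom (Fun_cat B Z) ((N \<odot> S) \<odot> S \<up> k) (N \<odot> S \<up> k \<odot> T)"
    unfolding lam_pow_def
    by (rule vcomp_in[OF hom_Fun_cong[OF whisker_left_in[OF _ chi_S_in] _ refl]],
        (rule functors)+, rule functor_comp_assoc[symmetric], (rule functors)+,
        (rule whisker_right_in lam_in functors)+)
  then show ?thesis
    using functor_comp_assoc[OF N_functor SS.endofunctor SS.pow_functor] by simp
qed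

lemmas pow_At [simp] = hom_Fun_At[OF rho_pow_in] hom_Fun_At[OF lam_pow_in]

lemma rho_pow_0: "y \<in> Ob Y \<Longrightarrow> At (rho_pow 0) y = At \<rho> y"
  by (simp add: rho_pow_def)

lemma rho_pow_Suc:
  "y \<in> Ob Y \<Longrightarrow> At (rho_pow (Suc n)) y
    = At \<chi> (OMap (T \<up> n) (OMap M y)) \<cdot>\<^bsub>B\<^esub> AMap T (At (rho_pow n) y)"
  by (simp add: rho_pow_def)

lemma lam_pow_0: "x \<in> Ob B \<Longrightarrow> At (lam_pow 0) x = At lam x"
  by (simp add: lam_pow_def)

lemma lam_pow_Suc:
  "x \<in> Ob B \<Longrightarrow> At (lam_pow (Suc k)) x
    = AMap N (AMap (S \<up> k) (At \<chi> x)) \<cdot>\<^bsub>Z\<^esub> At (lam_pow k) (OMap S x)"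
  by (simp add: lam_pow_def chi_S_Suc del: chi_S.simps)

lemma lam_pow_natural:
  "\<lbrakk>f \<in> Ar B; Cod B f = x\<rbrakk> \<Longrightarrow> At (lam_pow k) x \<cdot>\<^bsub>Z\<^esub> AMap N (AMap S (AMap (S \<up> k) f))
    = AMap N (AMap (S \<up> k) (AMap T f)) \<cdot>\<^bsub>Z\<^esub> At (lam_pow k) (Dom B f)"
  using hom_Fun_natural[OF lam_pow_in, of f x] by simp

lemma rho_pow_eps_T:
  assumes y: "y \<in> Ob Y"
  shows "AMap S (AMap (T \<up> i) (At \<epsilon>T (OMap (T \<up> c) (OMap M y)))) \<cdot>\<^bsub>B\<^esub> At (rho_pow (Suc (i + c))) y
    = At (rho_pow (i + c)) y \<cdot>\<^bsub>B\<^esub> AMap (T \<up> i) (At \<epsilon>T (OMap (T \<up> Suc c) (OMap M y)))"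
proof (induction i)
  case 0
  show ?case using y by (simp add: rho_pow_Suc[OF y, of c] naturality_simps)
next
  case (Suc i)
  show ?case
    using y arg_cong[OF Suc, of "\<lambda>f. At \<chi> (OMap (T \<up> (i + c)) (OMap M y)) \<cdot>\<^bsub>B\<^esub> AMap T f"]
    by (simp add: rho_pow_Suc[OF y] naturality_simps)
qed

lemma rho_pow_delta_T:
  assumes y: "y \<in> Ob Y"
  shows "AMap S (AMap (T \<up> i) (At \<Delta>T (OMap (T \<up> c) (OMap M y)))) \<cdot>\<^bsub>B\<^esub> At (rho_pow (Suc (i + c))) y
    = At (rho_pow (Suc (Suc (i + c)))) y \<cdot>\<^bsub>B\<^esub> AMap (T \<up> i) (At \<Delta>T (OMap (T \<up> Suc c) (OMap M y)))"
proof (induction i)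
  case 0
  show ?case using y by (simp add: rho_pow_Suc[OF y] naturality_simps)
next
  case (Suc i)
  show ?case
    using y arg_cong[OF Suc, of "\<lambda>f. At \<chi> (OMap (T \<up> Suc (Suc (i + c))) (OMap M y)) \<cdot>\<^bsub>B\<^esub> AMap T f"]
    by (simp add: rho_pow_Suc[OF y] naturality_simps)
qed

lemma rho_pow_eps_S:
  assumes y: "y \<in> Ob Y"
  shows "At \<epsilon>S (OMap (T \<up> m) (OMap M y)) \<cdot>\<^bsub>B\<^esub> At (rho_pow m) y = AMap (T \<up> m) (At \<epsilon>T (OMap M y))"
proof (induction m)
  case 0
  show ?case using y by (simp add: rho_pow_0 rho_laws)
next
  case (Suc m)
  show ?case
    using y arg_cong[OF Suc, of "AMap T"] by (simp add: rho_pow_Suc[OF y] naturality_simps)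
qed

lemma rho_pow_delta_S:
  assumes y: "y \<in> Ob Y"
  shows "At \<Delta>S (OMap (T \<up> m) (OMap M y)) \<cdot>\<^bsub>B\<^esub> At (rho_pow m) y
    = AMap S (At (rho_pow m) y) \<cdot>\<^bsub>B\<^esub> At (rho_pow (Suc m)) y \<cdot>\<^bsub>B\<^esub> AMap (T \<up> m) (At \<Delta>T (OMap M y))"
proof (induction m)
  case 0
  show ?case using y by (simp add: rho_pow_0 rho_laws rho_pow_Suc)
next
  case (Suc m)
  let ?x = "OMap (T \<up> m) (OMap M y)"
  show ?case
    using y arg_cong[OF Suc, of "\<lambda>f. AMap S (At \<chi> ?x) \<cdot>\<^bsub>B\<^esub> At \<chi> (OMap S ?x) \<cdot>\<^bsub>B\<^esub> AMap T f"]
    by (simp add: rho_pow_Suc[OF y] naturality_simps)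
qed

lemma lam_pow_eps_T:
  "x \<in> Ob B \<Longrightarrow> AMap N (AMap (S \<up> k) (At \<epsilon>T x)) \<cdot>\<^bsub>Z\<^esub> At (lam_pow k) x
    = AMap N (At \<epsilon>S (OMap (S \<up> k) x))"
proof (induction k arbitrary: x)
  case 0
  then show ?case by (simp add: lam_pow_0 lam_laws)
next
  case (Suc k)
  have "AMap N (AMap (S \<up> Suc k) (At \<epsilon>T x)) \<cdot>\<^bsub>Z\<^esub> AMap N (AMap (S \<up> k) (At \<chi> x))
    = AMap N (AMap (S \<up> k) (At \<epsilon>T (OMap S x)))"
    using Suc.prems arg_cong[OF chi_laws(1)[of x], of "\<lambda>f. AMap N (AMap (S \<up> k) f)"] by simp
  from N.B.Comp_extend[OF this, of "At (lam_pow k) (OMap S x)"] show ?case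
    using Suc.prems by (simp add: lam_pow_Suc Suc.IH)
qed

lemma lam_pow_delta_T:
  "x \<in> Ob B \<Longrightarrow> AMap N (AMap (S \<up> k) (At \<Delta>T x)) \<cdot>\<^bsub>Z\<^esub> At (lam_pow k) x
    = At (lam_pow k) (OMap T x) \<cdot>\<^bsub>Z\<^esub> At (lam_pow (Suc k)) x
      \<cdot>\<^bsub>Z\<^esub> AMap N (At \<Delta>S (OMap (S \<up> k) x))"
proof (induction k arbitrary: x)
  case 0
  then show ?case by (simp add: lam_pow_0 lam_laws lam_pow_Suc)
next
  case (Suc k)
  have "AMap N (AMap (S \<up> Suc k) (At \<Delta>T x)) \<cdot>\<^bsub>Z\<^esub> AMap N (AMap (S \<up> k) (At \<chi> x))
    = AMap N (AMap (S \<up> k) (At \<chi> (OMap T x))) \<cdot>\<^bsub>Z\<^esub> AMap N (AMap (S \<up> k) (AMap T (At \<chi> x)))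
      \<cdot>\<^bsub>Z\<^esub> AMap N (AMap (S \<up> k) (At \<Delta>T (OMap S x)))"
    using Suc.prems arg_cong[OF chi_laws(2)[of x], of "\<lambda>f. AMap N (AMap (S \<up> k) f)"] by simp
  from N.B.Comp_extend[OF this, of "At (lam_pow k) (OMap S x)"]
  show ?case
    using Suc.prems N.B.Comp_extend[OF lam_pow_natural[of "At \<chi> x" _ k]]
    by (simp add: lam_pow_Suc[of x "Suc k"] lam_pow_Suc[of x k] lam_pow_Suc[of "OMap T x" k] Suc.IH)
qed

lemma lam_pow_eps_S:
  "x \<in> Ob B \<Longrightarrow>
    AMap N (AMap (S \<up> a) (At \<epsilon>S (OMap (S \<up> i) (OMap T x)))) \<cdot>\<^bsub>Z\<^esub> At (lam_pow (Suc (a + i))) x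
    = At (lam_pow (a + i)) x \<cdot>\<^bsub>Z\<^esub> AMap N (AMap (S \<up> Suc a) (At \<epsilon>S (OMap (S \<up> i) x)))"
proof (induction i arbitrary: x)
  case 0
  have "AMap N (AMap (S \<up> a) (At \<epsilon>S (OMap T x))) \<cdot>\<^bsub>Z\<^esub> AMap N (AMap (S \<up> a) (At \<chi> x))
    = AMap N (AMap (S \<up> a) (AMap T (At \<epsilon>S x)))"
    using 0 arg_cong[OF chi_laws(3)[of x], of "\<lambda>f. AMap N (AMap (S \<up> a) f)"] by simp
  from N.B.Comp_extend[OF this, of "At (lam_pow a) (OMap S x)"] show ?case
    using 0 by (simp add: lam_pow_Suc lam_pow_natural)
next
  case (Suc i)
  have "AMap N (AMap (S \<up> a) (At \<epsilon>S (OMap (S \<up> Suc i) (OMap T x))))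
      \<cdot>\<^bsub>Z\<^esub> AMap N (AMap (S \<up> (a + Suc i)) (At \<chi> x))
    = AMap N (AMap (S \<up> (a + i)) (At \<chi> x))
      \<cdot>\<^bsub>Z\<^esub> AMap N (AMap (S \<up> a) (At \<epsilon>S (OMap (S \<up> i) (OMap T (OMap S x)))))"
    using Suc.prems arg_cong[OF SS.counit_natural[of "AMap (S \<up> i) (At \<chi> x)", OF _ refl],
        of "\<lambda>f. AMap N (AMap (S \<up> a) f)"] by simp
  from N.B.Comp_extend[OF this, of "At (lam_pow (Suc (a + i))) (OMap S x)"] show ?case
    using Suc.prems
    by (simp add: lam_pow_Suc[of x "Suc (a + i)"] lam_pow_Suc[of x "a + i"] Suc.IH)
qed

lemma lam_pow_delta_S:
  "x \<in> Ob B \<Longrightarrow>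
    AMap N (AMap (S \<up> a) (At \<Delta>S (OMap (S \<up> i) (OMap T x)))) \<cdot>\<^bsub>Z\<^esub> At (lam_pow (Suc (a + i))) x
    = At (lam_pow (Suc (Suc (a + i)))) x
      \<cdot>\<^bsub>Z\<^esub> AMap N (AMap (S \<up> Suc a) (At \<Delta>S (OMap (S \<up> i) x)))"
proof (induction i arbitrary: x)
  case 0
  have "AMap N (AMap (S \<up> a) (At \<Delta>S (OMap T x))) \<cdot>\<^bsub>Z\<^esub> AMap N (AMap (S \<up> a) (At \<chi> x))
    = AMap N (AMap (S \<up> a) (AMap S (At \<chi> x))) \<cdot>\<^bsub>Z\<^esub> AMap N (AMap (S \<up> a) (At \<chi> (OMap S x)))
      \<cdot>\<^bsub>Z\<^esub> AMap N (AMap (S \<up> a) (AMap T (At \<Delta>S x)))"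
    using 0 arg_cong[OF chi_laws(4)[of x], of "\<lambda>f. AMap N (AMap (S \<up> a) f)"] by simp
  from N.B.Comp_extend[OF this, of "At (lam_pow a) (OMap S x)"] show ?case
    using 0 by (simp add: lam_pow_Suc lam_pow_natural)
next
  case (Suc i)
  have "AMap N (AMap (S \<up> a) (At \<Delta>S (OMap (S \<up> Suc i) (OMap T x))))
      \<cdot>\<^bsub>Z\<^esub> AMap N (AMap (S \<up> (a + Suc i)) (At \<chi> x))
    = AMap N (AMap (S \<up> (Suc (Suc (a + i)))) (At \<chi> x))
      \<cdot>\<^bsub>Z\<^esub> AMap N (AMap (S \<up> a) (At \<Delta>S (OMap (S \<up> i) (OMap T (OMap S x)))))"
    using Suc.prems arg_cong[OF SS.comult_natural[of "AMap (S \<up> i) (At \<chi> x)", OF _ refl],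
        of "\<lambda>f. AMap N (AMap (S \<up> a) f)"] by simp
  from N.B.Comp_extend[OF this, of "At (lam_pow (Suc (a + i))) (OMap S x)"] show ?case
    using Suc.prems
    by (simp add: lam_pow_Suc[of x "Suc (a + i)"] lam_pow_Suc[of x "Suc (Suc (a + i))"] Suc.IH)
qed

definition word :: "nat \<Rightarrow> nat \<Rightarrow> ('oy, 'ay, 'oz, 'az) ftor" where
  "word k m = N \<odot> S \<up> k \<odot> T \<up> m \<odot> M"

definition rstep :: "nat \<Rightarrow> nat \<Rightarrow> ('oy, 'ay, 'oz, 'az) ntrans" where
  "rstep k m = N \<odot> S \<up> k \<triangleright> rho_pow m"

definition lstep :: "nat \<Rightarrow> nat \<Rightarrow> ('oy, 'ay, 'oz, 'az) ntrans" where
  "lstep k m = lam_pow k \<triangleleft> T \<up> m \<odot> M"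

lemma word_alt: "(N \<odot> S \<up> k) \<odot> T \<up> m \<odot> M = word k m"
  unfolding word_def by (rule functor_comp_assoc, (rule functors)+)

lemma word_in: "is_functor Y Z (word k m)"
  unfolding word_def by (rule functors)+

lemma rstep_in: "rstep k m \<in> hom (Fun_cat Y Z) (word k (Suc m)) (word (Suc k) m)"
proof -
  have "rstep k m \<in> hom (Fun_cat Y Z) ((N \<odot> S \<up> k) \<odot> T \<up> Suc m \<odot> M)
      ((N \<odot> S \<up> k) \<odot> S \<odot> T \<up> m \<odot> M)"
    unfolding rstep_def by (rule whisker_left_in rho_pow_in functors)+
  moreover have "(N \<odot> S \<up> k) \<odot> S \<odot> T \<up> m \<odot> M = word (Suc k) m"
    unfolding word_def by (rule functor_eqI, (rule functors)+, simp_all)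
  ultimately show ?thesis by (simp only: word_alt)
qed

lemma lstep_in: "lstep k m \<in> hom (Fun_cat Y Z) (word (Suc k) m) (word k (Suc m))"
proof -
  have "lstep k m \<in> hom (Fun_cat Y Z) ((N \<odot> S \<up> Suc k) \<odot> T \<up> m \<odot> M)
      ((N \<odot> S \<up> k \<odot> T) \<odot> T \<up> m \<odot> M)"
    unfolding lstep_def by (rule whisker_right_in lam_pow_in functors)+
  moreover have "(N \<odot> S \<up> k \<odot> T) \<odot> T \<up> m \<odot> M = word k (Suc m)"
    unfolding word_def by (rule functor_eqI, (rule functors)+, simp_all)
  ultimately show ?thesis by (simp only: word_alt)
qed

definition epsT :: "nat \<Rightarrow> nat \<Rightarrow> nat \<Rightarrow> ('oy, 'ay, 'oz, 'az) ntrans" where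
  "epsT k m i = comonad_context.eps T \<epsilon>T (N \<odot> S \<up> k) M i (m - i)"

definition deltaT :: "nat \<Rightarrow> nat \<Rightarrow> nat \<Rightarrow> ('oy, 'ay, 'oz, 'az) ntrans" where
  "deltaT k m i = comonad_context.delta T \<Delta>T (N \<odot> S \<up> k) M i (m - i)"

definition epsS :: "nat \<Rightarrow> nat \<Rightarrow> nat \<Rightarrow> ('oy, 'ay, 'oz, 'az) ntrans" where
  "epsS k m i = comonad_context.eps S \<epsilon>S N (T \<up> m \<odot> M) (k - i) i"

definition deltaS :: "nat \<Rightarrow> nat \<Rightarrow> nat \<Rightarrow> ('oy, 'ay, 'oz, 'az) ntrans" where
  "deltaS k m i = comonad_context.delta S \<Delta>S N (T \<up> m \<odot> M) (k - i) i"

lemma generators_in: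
  "i \<le> m \<Longrightarrow> epsT k m i \<in> hom (Fun_cat Y Z) (word k (Suc m)) (word k m)"
  "i \<le> m \<Longrightarrow> deltaT k m i \<in> hom (Fun_cat Y Z) (word k (Suc m)) (word k (Suc (Suc m)))"
  "i \<le> k \<Longrightarrow> epsS k m i \<in> hom (Fun_cat Y Z) (word (Suc k) m) (word k m)"
  "i \<le> k \<Longrightarrow> deltaS k m i \<in> hom (Fun_cat Y Z) (word (Suc k) m) (word (Suc (Suc k)) m)"
  using CT.eps_in[of k i "m - i"] CT.delta_in[of k i "m - i"]
    CS.eps_in[of m "k - i" i] CS.delta_in[of m "k - i" i]
  by (simp_all only: epsT_def deltaT_def epsS_def deltaS_def word_alt word_def[symmetric]
      le_add_diff_inverse le_add_diff_inverse2)

lemma arrows [simp]: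
  "is_functor Y Z (word k m)"
  "is_ntrans Y Z (rstep k m)" "NDom (rstep k m) = word k (Suc m)" "NCod (rstep k m) = word (Suc k) m"
  "is_ntrans Y Z (lstep k m)" "NDom (lstep k m) = word (Suc k) m" "NCod (lstep k m) = word k (Suc m)"
  "i \<le> m \<Longrightarrow> is_ntrans Y Z (epsT k m i)" "i \<le> m \<Longrightarrow> NDom (epsT k m i) = word k (Suc m)"
  "i \<le> m \<Longrightarrow> NCod (epsT k m i) = word k m"
  "i \<le> m \<Longrightarrow> is_ntrans Y Z (deltaT k m i)" "i \<le> m \<Longrightarrow> NDom (deltaT k m i) = word k (Suc m)"
  "i \<le> m \<Longrightarrow> NCod (deltaT k m i) = word k (Suc (Suc m))"
  "i \<le> k \<Longrightarrow> is_ntrans Y Z (epsS k m i)" "i \<le> k \<Longrightarrow> NDom (epsS k m i) = word (Suc k) m"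
  "i \<le> k \<Longrightarrow> NCod (epsS k m i) = word k m"
  "i \<le> k \<Longrightarrow> is_ntrans Y Z (deltaS k m i)" "i \<le> k \<Longrightarrow> NDom (deltaS k m i) = word (Suc k) m"
  "i \<le> k \<Longrightarrow> NCod (deltaS k m i) = word (Suc (Suc k)) m"
  using word_in rstep_in lstep_in generators_in unfolding hom_Fun_iff by simp_all

lemma word_Src_Tgt [simp]: "Src (word k m) = Y" "Tgt (word k m) = Z"
  using word_in is_functor.functor_simps(1,2) by blast+

lemma arrows_At [simp]:
  assumes "y \<in> Ob Y"
  shows "At (rstep k m) y = AMap N (AMap (S \<up> k) (At (rho_pow m) y))"
    "At (lstep k m) y = At (lam_pow k) (OMap (T \<up> m) (OMap M y))"
    "At (epsT k m i) y
      = AMap N (AMap (S \<up> k) (AMap (T \<up> i) (At \<epsilon>T (OMap (T \<up> (m - i)) (OMap M y)))))"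
    "At (deltaT k m i) y
      = AMap N (AMap (S \<up> k) (AMap (T \<up> i) (At \<Delta>T (OMap (T \<up> (m - i)) (OMap M y)))))"
    "At (epsS k m i) y
      = AMap N (AMap (S \<up> (k - i)) (At \<epsilon>S (OMap (S \<up> i) (OMap (T \<up> m) (OMap M y)))))"
    "At (deltaS k m i) y
      = AMap N (AMap (S \<up> (k - i)) (At \<Delta>S (OMap (S \<up> i) (OMap (T \<up> m) (OMap M y)))))"
  using assms by (simp_all add: rstep_def lstep_def epsT_def deltaT_def epsS_def deltaS_def)

lemma rstep_eps_T: "i \<le> m \<Longrightarrow> epsT (Suc k) m i \<bullet> rstep k (Suc m) = rstep k m \<bullet> epsT k (Suc m) i"
proof (rule ntrans_eqI'[of Y Z])
  fix y assume i: "i \<le> m" and y: "y \<in> Ob Y"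
  obtain c where m: "m = i + c" using i by (metis le_add_diff_inverse)
  show "At (epsT (Suc k) m i \<bullet> rstep k (Suc m)) y = At (rstep k m \<bullet> epsT k (Suc m) i) y"
    using y arg_cong[OF rho_pow_eps_T[OF y, of i c], of "\<lambda>f. AMap N (AMap (S \<up> k) f)"]
    by (simp add: m Suc_diff_le)
qed simp_all

lemma rstep_delta_T:
  "i \<le> m \<Longrightarrow> deltaT (Suc k) m i \<bullet> rstep k (Suc m) = rstep k (Suc (Suc m)) \<bullet> deltaT k (Suc m) i"
proof (rule ntrans_eqI'[of Y Z])
  fix y assume i: "i \<le> m" and y: "y \<in> Ob Y"
  obtain c where m: "m = i + c" using i by (metis le_add_diff_inverse)
  show "At (deltaT (Suc k) m i \<bullet> rstep k (Suc m)) y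
    = At (rstep k (Suc (Suc m)) \<bullet> deltaT k (Suc m) i) y"
    using y arg_cong[OF rho_pow_delta_T[OF y, of i c], of "\<lambda>f. AMap N (AMap (S \<up> k) f)"]
    by (simp add: m Suc_diff_le)
qed simp_all

lemma rstep_eps_S_0: "epsS k m 0 \<bullet> rstep k m = epsT k m m"
proof (rule ntrans_eqI'[of Y Z])
  fix y assume y: "y \<in> Ob Y"
  show "At (epsS k m 0 \<bullet> rstep k m) y = At (epsT k m m) y"
    using y arg_cong[OF rho_pow_eps_S[OF y, of m], of "\<lambda>f. AMap N (AMap (S \<up> k) f)"] by simp
qed simp_all

lemma rstep_delta_S_0:
  "deltaS k m 0 \<bullet> rstep k m = rstep (Suc k) m \<bullet> rstep k (Suc m) \<bullet> deltaT k m m"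
proof (rule ntrans_eqI'[of Y Z])
  fix y assume y: "y \<in> Ob Y"
  show "At (deltaS k m 0 \<bullet> rstep k m) y
    = At (rstep (Suc k) m \<bullet> rstep k (Suc m) \<bullet> deltaT k m m) y"
    using y arg_cong[OF rho_pow_delta_S[OF y, of m], of "\<lambda>f. AMap N (AMap (S \<up> k) f)"] by simp
qed simp_all

lemma rstep_eps_S: "i \<le> k \<Longrightarrow> epsS (Suc k) m (Suc i) \<bullet> rstep (Suc k) m = rstep k m \<bullet> epsS k (Suc m) i"
proof (rule ntrans_eqI'[of Y Z])
  fix y assume i: "i \<le> k" and y: "y \<in> Ob Y"
  obtain c where k: "k = c + i" using i by (metis le_add_diff_inverse2)
  show "At (epsS (Suc k) m (Suc i) \<bullet> rstep (Suc k) m) y = At (rstep k m \<bullet> epsS k (Suc m) i) y"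
    using y arg_cong[OF SS.counit_natural[of "AMap (S \<up> i) (At (rho_pow m) y)", OF _ refl],
        of "\<lambda>f. AMap N (AMap (S \<up> c) f)"]
    by (simp add: k)
qed simp_all

lemma rstep_delta_S:
  "i \<le> k \<Longrightarrow> deltaS (Suc k) m (Suc i) \<bullet> rstep (Suc k) m = rstep (Suc (Suc k)) m \<bullet> deltaS k (Suc m) i"
proof (rule ntrans_eqI'[of Y Z])
  fix y assume i: "i \<le> k" and y: "y \<in> Ob Y"
  obtain c where k: "k = c + i" using i by (metis le_add_diff_inverse2)
  show "At (deltaS (Suc k) m (Suc i) \<bullet> rstep (Suc k) m) y
    = At (rstep (Suc (Suc k)) m \<bullet> deltaS k (Suc m) i) y"
    using y arg_cong[OF SS.comult_natural[of "AMap (S \<up> i) (At (rho_pow m) y)", OF _ refl],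
        of "\<lambda>f. AMap N (AMap (S \<up> c) f)"]
    by (simp add: k)
qed simp_all

lemma lstep_eps_S: "i \<le> k \<Longrightarrow> epsS k (Suc m) i \<bullet> lstep (Suc k) m = lstep k m \<bullet> epsS (Suc k) m i"
proof (rule ntrans_eqI'[of Y Z])
  fix y assume i: "i \<le> k" and y: "y \<in> Ob Y"
  obtain a where k: "k = a + i" using i by (metis le_add_diff_inverse2)
  show "At (epsS k (Suc m) i \<bullet> lstep (Suc k) m) y = At (lstep k m \<bullet> epsS (Suc k) m i) y"
    using y lam_pow_eps_S[of "OMap (T \<up> m) (OMap M y)" a i] by (simp add: k Suc_diff_le)
qed simp_all

lemma lstep_delta_S:
  "i \<le> k \<Longrightarrow> deltaS k (Suc m) i \<bullet> lstep (Suc k) m = lstep (Suc (Suc k)) m \<bullet> deltaS (Suc k) m i"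
proof (rule ntrans_eqI'[of Y Z])
  fix y assume i: "i \<le> k" and y: "y \<in> Ob Y"
  obtain a where k: "k = a + i" using i by (metis le_add_diff_inverse2)
  show "At (deltaS k (Suc m) i \<bullet> lstep (Suc k) m) y
    = At (lstep (Suc (Suc k)) m \<bullet> deltaS (Suc k) m i) y"
    using y lam_pow_delta_S[of "OMap (T \<up> m) (OMap M y)" a i] by (simp add: k Suc_diff_le)
qed simp_all

lemma lstep_eps_T_0: "epsT k m 0 \<bullet> lstep k m = epsS k m k"
proof (rule ntrans_eqI'[of Y Z])
  fix y assume y: "y \<in> Ob Y"
  show "At (epsT k m 0 \<bullet> lstep k m) y = At (epsS k m k) y"
    using y by (simp add: lam_pow_eps_T)
qed simp_all

lemma lstep_delta_T_0:
  "deltaT k m 0 \<bullet> lstep k m = lstep k (Suc m) \<bullet> lstep (Suc k) m \<bullet> deltaS k m k"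
proof (rule ntrans_eqI'[of Y Z])
  fix y assume y: "y \<in> Ob Y"
  show "At (deltaT k m 0 \<bullet> lstep k m) y
    = At (lstep k (Suc m) \<bullet> lstep (Suc k) m \<bullet> deltaS k m k) y"
    using y by (simp add: lam_pow_delta_T)
qed simp_all

lemma lstep_eps_T: "i \<le> m \<Longrightarrow> epsT k (Suc m) (Suc i) \<bullet> lstep k (Suc m) = lstep k m \<bullet> epsT (Suc k) m i"
proof (rule ntrans_eqI'[of Y Z])
  fix y assume i: "i \<le> m" and y: "y \<in> Ob Y"
  obtain c where m: "m = i + c" using i by (metis le_add_diff_inverse)
  show "At (epsT k (Suc m) (Suc i) \<bullet> lstep k (Suc m)) y = At (lstep k m \<bullet> epsT (Suc k) m i) y"
    using y by (simp add: m lam_pow_natural)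
qed simp_all

lemma lstep_delta_T:
  "i \<le> m \<Longrightarrow> deltaT k (Suc m) (Suc i) \<bullet> lstep k (Suc m) = lstep k (Suc (Suc m)) \<bullet> deltaT (Suc k) m i"
proof (rule ntrans_eqI'[of Y Z])
  fix y assume i: "i \<le> m" and y: "y \<in> Ob Y"
  obtain c where m: "m = i + c" using i by (metis le_add_diff_inverse)
  show "At (deltaT k (Suc m) (Suc i) \<bullet> lstep k (Suc m)) y
    = At (lstep k (Suc (Suc m)) \<bullet> deltaT (Suc k) m i) y"
    using y by (simp add: m lam_pow_natural)
qed simp_all

lemma lstep_rstep: "lstep (Suc k) m \<bullet> rstep (Suc k) m = rstep k (Suc m) \<bullet> lstep k (Suc m)"
proof (rule ntrans_eqI'[of Y Z])
  fix y assume y: "y \<in> Ob Y"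
  show "At (lstep (Suc k) m \<bullet> rstep (Suc k) m) y = At (rstep k (Suc m) \<bullet> lstep k (Suc m)) y"
    using y by (simp add: lam_pow_Suc rho_pow_Suc lam_pow_natural)
qed simp_all

sublocale slide: sliding_pair "Fun_cat Y Z" word rstep lstep epsT deltaT epsS deltaS
proof (intro sliding_pair.intro sliding.intro sliding_axioms.intro sliding_pair_axioms.intro
    category_Fun_cat generators_in rstep_in lstep_in; (unfold Fun_cat_simps)?)
  show "simplicial_object (Fun_cat Y Z) (sliding_data (Fun_cat Y Z) word rstep lstep epsT deltaT)"
    by (rule CT.simplicial_bar[of _ 0]) (simp_all only: sliding_data_simps word_alt epsT_def deltaT_def)
  let ?S = "sliding_data (Fun_cat Y Z) (\<lambda>k m. word m k) (\<lambda>k m. lstep m k) (\<lambda>k m. rstep m k)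
    (\<lambda>k m. epsS m k) (\<lambda>k m. deltaS m k)"
  let ?S' = "\<lparr>cells = cells ?S, face = (\<lambda>n i. epsS n 0 (n - i)), degen = (\<lambda>n i. deltaS n 0 (n - i))\<rparr>"
  have "simplicial_object (Fun_cat Y Z) ?S'"
    by (rule CS.simplicial_bar[of _ 0]) (simp_all add: sliding_data_def word_def epsS_def deltaS_def)
  then show "simplicial_object (Fun_cat Y Z) ?S"
    by (rule simplicial_object_reverse) simp_all
qed (simp_all add: rstep_eps_T rstep_delta_T rstep_eps_S_0 rstep_delta_S_0 rstep_eps_S rstep_delta_S
    lstep_eps_T lstep_delta_T lstep_eps_T_0 lstep_delta_T_0 lstep_eps_S lstep_delta_S lstep_rstep)

lemma word_0: "N \<odot> S \<up> 0 = N" "T \<up> 0 \<odot> M = M"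
  using functor_comp_id(2)[OF N_functor] functor_comp_id(1)[OF M_functor] by simp_all

lemma rstep_eq:
  "rstep k m = (N \<odot> S \<up> k \<triangleright> chi_T T S \<chi> m \<triangleleft> M) \<bullet> (N \<odot> S \<up> k \<odot> T \<up> m \<triangleright> \<rho>)"
proof -
  have NS: "is_functor B Z (N \<odot> S \<up> k)" by (rule functors)+
  have chi: "chi_T T S \<chi> m \<triangleleft> M \<in> hom (Fun_cat Y B) (T \<up> m \<odot> S \<odot> M) ((S \<odot> T \<up> m) \<odot> M)"
    unfolding functor_comp_assoc[OF TT.pow_functor SS.endofunctor M_functor, symmetric]
    by (rule whisker_right_in chi_T_in functors)+
  have rho: "T \<up> m \<triangleright> \<rho> \<in> hom (Fun_cat Y B) (T \<up> m \<odot> T \<odot> M) (T \<up> m \<odot> S \<odot> M)"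
    by (rule whisker_left_in rho_in functors)+
  show ?thesis
    unfolding rstep_def rho_pow_def whisker_left_vcomp[OF NS chi rho]
      functor_comp_assoc[OF N_functor SS.pow_functor TT.pow_functor, symmetric]
      whisker_left_comp[OF NS TT.pow_functor rho_in] ..
qed

lemma lstep_eq:
  "lstep k m = (N \<triangleright> chi_S T S \<chi> k \<triangleleft> T \<up> m \<odot> M) \<bullet> (lam \<triangleleft> S \<up> k \<odot> T \<up> m \<odot> M)"
proof -
  have TM: "is_functor Y B (T \<up> m \<odot> M)" by (rule functors)+
  have chi: "N \<triangleright> chi_S T S \<chi> k \<in> hom (Fun_cat B Z) ((N \<odot> T) \<odot> S \<up> k) (N \<odot> S \<up> k \<odot> T)"
    unfolding functor_comp_assoc[OF N_functor TT.endofunctor SS.pow_functor]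
    by (rule whisker_left_in chi_S_in functors)+
  have lam: "lam \<triangleleft> S \<up> k \<in> hom (Fun_cat B Z) ((N \<odot> S) \<odot> S \<up> k) ((N \<odot> T) \<odot> S \<up> k)"
    by (rule whisker_right_in lam_in functors)+
  show ?thesis
    unfolding lstep_def lam_pow_def whisker_right_vcomp[OF TM chi lam]
      whisker_left_right[OF N_functor TM chi_S_in] whisker_right_comp[OF SS.pow_functor TM lam_in] ..
qed

lemma lam_pow_0_eq: "lam_pow 0 = lam"
  using functor_comp_id(2)[OF N_functor] functor_comp_id[OF SS.endofunctor]
    functor_comp_id(1)[OF TT.endofunctor]
  by (intro ntrans_eqI[OF lam_pow_in[of 0]]) (use lam_in in \<open>simp_all add: lam_pow_0\<close>)

lemma rho_pow_0_eq: "rho_pow 0 = \<rho>"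
  using functor_comp_id(1)[OF M_functor] functor_comp_id[OF TT.endofunctor]
  by (intro ntrans_eqI[OF rho_pow_in[of 0]]) (use rho_in in \<open>simp_all add: rho_pow_0\<close>)

lemma t_T_eq: "t_T T S \<chi> N lam M \<rho> n = lstep 0 n \<bullet> rstep 0 n"
proof -
  have "N \<odot> S \<up> 0 \<odot> T \<up> n = N \<odot> T \<up> n"
    using functor_comp_id(1)[OF TT.pow_functor] by simp
  then show ?thesis
    unfolding t_T_def lstep_def rstep_eq lam_pow_0_eq word_0 by simp
qed

lemma t_S_eq: "t_S T S \<chi> N lam M \<rho> n = rstep n 0 \<bullet> lstep n 0"
  unfolding t_S_def rstep_def lstep_eq rho_pow_0_eq word_0 ..

lemma C_T_eq: "C_T T \<Delta>T \<epsilon>T S \<chi> N lam M \<rho> = slide.XT"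
proof -
  have "epsT 0 n i = N \<odot> T \<up> i \<triangleright> \<epsilon>T \<triangleleft> T \<up> (n - i) \<odot> M"
    "deltaT 0 n i = N \<odot> T \<up> i \<triangleright> \<Delta>T \<triangleleft> T \<up> (n - i) \<odot> M"
    "word 0 n = N \<odot> T \<up> n \<odot> M" for n i
    unfolding epsT_def deltaT_def CT.eps_def CT.delta_def word_alt[symmetric]
    unfolding word_0 by simp_all
  then show ?thesis
    by (simp add: C_T_def sliding_data_def fun_eq_iff t_T_eq)
qed

lemma C_S_op_eq: "C_S_op T S \<Delta>S \<epsilon>S \<chi> N lam M \<rho> = slide.XS"
proof -
  have "epsS n 0 i = N \<odot> S \<up> (n - i) \<triangleright> \<epsilon>S \<triangleleft> S \<up> i \<odot> M"
    "deltaS n 0 i = N \<odot> S \<up> (n - i) \<triangleright> \<Delta>S \<triangleleft> S \<up> i \<odot> M"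
    "word n 0 = N \<odot> S \<up> n \<odot> M" for n i
    unfolding epsS_def deltaS_def CS.eps_def CS.delta_def word_def
    unfolding word_0 by simp_all
  then show ?thesis
    by (simp add: C_S_op_def sliding_data_def fun_eq_iff t_S_eq)
qed

lemma R_mor_eq: "R_mor T S \<chi> N M \<rho> n = slide.R.run 0 (Suc n) 0"
  using run_eq_vcomp_upto[OF slide.R.sliding_axioms, of n "r_step T S \<chi> N M \<rho> n" n]
  by (simp add: R_mor_def r_step_def rstep_eq)

lemma L_mor_eq: "L_mor T S \<chi> N lam M n = slide.L.run 0 (Suc n) 0"
  using run_eq_vcomp_upto[OF slide.L.sliding_axioms, of n "l_step T S \<chi> N lam M n" n]
  by (simp add: L_mor_def l_step_def lstep_eq)

sublocale slide_flip: sliding_pair "Fun_cat Y Z" "\<lambda>k m. word m k" "\<lambda>k m. lstep m k" "\<lambda>k m. rstep m k"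
  "\<lambda>k m. epsS m k" "\<lambda>k m. deltaS m k" "\<lambda>k m. epsT m k" "\<lambda>k m. deltaT m k"
  by (fact slide.flip)

end

theorem proposition4p4:
  fixes B :: "('ob, 'ab) cat" and Y :: "('oy, 'ay) cat" and Z :: "('oz, 'az) cat"
    and T S :: "('ob, 'ab, 'ob, 'ab) ftor"
    and \<Delta>T \<epsilon>T \<Delta>S \<epsilon>S \<chi> :: "('ob, 'ab, 'ob, 'ab) ntrans"
    and M :: "('oy, 'ay, 'ob, 'ab) ftor" and \<rho> :: "('oy, 'ay, 'ob, 'ab) ntrans"
    and N :: "('ob, 'ab, 'oz, 'az) ftor" and lam :: "('ob, 'ab, 'oz, 'az) ntrans"
  defines "CT \<equiv> C_T T \<Delta>T \<epsilon>T S \<chi> N lam M \<rho>"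
    and "CS \<equiv> C_S_op T S \<Delta>S \<epsilon>S \<chi> N lam M \<rho>"
    and "R \<equiv> R_mor T S \<chi> N M \<rho>"
    and "L \<equiv> L_mor T S \<chi> N lam M"
  assumes "category B" and "category Y" and "category Z"
    and "comonad B T \<Delta>T \<epsilon>T" and "comonad B S \<Delta>S \<epsilon>S"
    and "comonad_distributive_law B T \<Delta>T \<epsilon>T S \<Delta>S \<epsilon>S \<chi>"
    and "right_coalgebra B T \<Delta>T \<epsilon>T S \<Delta>S \<epsilon>S \<chi> Y M \<rho>"
    and "left_coalgebra B T \<Delta>T \<epsilon>T S \<Delta>S \<epsilon>S \<chi> Z N lam"
  shows "duplicial_morphism (Fun_cat Y Z) CT CS R
    \<and> duplicial_morphism (Fun_cat Y Z) CS CT L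
    \<and> (mor_comp (Fun_cat Y Z) L R = id_mor (Fun_cat Y Z) CT \<longleftrightarrow> cyclic_object (Fun_cat Y Z) CT)
    \<and> (mor_comp (Fun_cat Y Z) R L = id_mor (Fun_cat Y Z) CS \<longleftrightarrow> cyclic_object (Fun_cat Y Z) CS)"
proof -
  interpret coalgebra_pair B T \<Delta>T \<epsilon>T S \<Delta>S \<epsilon>S \<chi> Y M \<rho> Z N lam
    using assms by (intro coalgebra_pair.intro)
  have R: "R n = slide.R.run 0 (Suc n) 0" and L: "L n = slide.L.run 0 (Suc n) 0" for n
    by (simp_all only: R_def L_def R_mor_eq L_mor_eq)
  have "duplicial_morphism (Fun_cat Y Z) CT CS R"
    using slide.morphism[OF slide_flip.duplicial_T]
    by (simp only: CT_def CS_def C_T_eq C_S_op_eq R[abs_def])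
  moreover have "duplicial_morphism (Fun_cat Y Z) CS CT L"
    using slide_flip.morphism[OF slide.duplicial_T]
    by (simp only: CT_def CS_def C_T_eq C_S_op_eq L[abs_def])
  moreover have "mor_comp (Fun_cat Y Z) L R = id_mor (Fun_cat Y Z) CT \<longleftrightarrow> cyclic_object (Fun_cat Y Z) CT"
    unfolding CT_def C_T_eq by (rule slide.cyclic_iff[OF L R])
  moreover have "mor_comp (Fun_cat Y Z) R L = id_mor (Fun_cat Y Z) CS \<longleftrightarrow> cyclic_object (Fun_cat Y Z) CS"
    unfolding CS_def C_S_op_eq by (rule slide_flip.cyclic_iff[OF R L])
  ultimately show ?thesis by blast
qed

end
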